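(* For a commutative semigroup variety $\mathcal V$, the following are equivalent: (a) $\mathcal V$ is both a modular and an upper-modular element of the lattice $\mathbf{Com}$; (b) $\mathcal V$ is a costandard element of the lattice $\mathbf{Com}$; (c) either $\mathcal V=\mathcal{COM}$, or $\mathcal V=\mathcal M\vee\mathcal N$ where $\mathcal M$ is one of the varieties $\mathcal T$ or $\mathcal{SL}$, and $\mathcal N$ is a commutative semigroup variety satisfying the identities $x^2yz=0$ and $x^2y=xy^2$.
   Context: A semigroup variety is a class of semigroups defined by a system of semigroup identities; it is commutative if it satisfies $xy=yx$. $\mathbf{Com}$ is the lattice of all commutative semigroup varieties ordered by inclusion (meet $\wedge$ is intersection; join $\vee$ is the least variety containing both). $\mathcal T$, $\mathcal{SL}$, $\mathcal{COM}$ denote the trivial variety, the variety of semilattices, and the variety of all commutative semigroups. For a word $w$, the notation $w=0$ is a short form of the identity system $wx=xw=w$ where $x$ is a letter not occurring in $w$ (equivalently, the semigroup has a zero element $0$ and all values of $w$ equal $0$). An element $x$ of a lattice $L$ is called: modular if for all $y,z\in L$, $y\le z$ implies $(x\vee y)\wedge z=(x\wedge z)\vee y$; upper-modular if for all $y,z\in L$, $y\le x$ implies $x\wedge(y\vee z)=y\vee(x\wedge z)$; costandard if $(x\wedge y)\vee z=(x\vee z)\wedge(y\vee z)$ for all $y,z\in L$. *)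

theory Defs
  imports "HOL-Algebra.Lattice"
begin

record 'u sgrp = "'u partial_object" +
  sgrp_mult :: "'u \<Rightarrow> 'u \<Rightarrow> 'u" (infixl "\<cdot>\<index>" 70)

definition is_semigroup :: "'u sgrp \<Rightarrow> bool" where
  "is_semigroup S \<longleftrightarrow>
     carrier S \<noteq> {} \<and>
     (\<forall>a\<in>carrier S. \<forall>b\<in>carrier S. a \<cdot>\<^bsub>S\<^esub> b \<in> carrier S) \<and>
     (\<forall>a\<in>carrier S. \<forall>b\<in>carrier S. \<forall>c\<in>carrier S.
        (a \<cdot>\<^bsub>S\<^esub> b) \<cdot>\<^bsub>S\<^esub> c = a \<cdot>\<^bsub>S\<^esub> (b \<cdot>\<^bsub>S\<^esub> c))"

text \<open>Semigroup words are the nonempty lists over the countable alphabet of natural numbers.\<close>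

type_synonym word = "nat list"

type_synonym identity = "word \<times> word"

definition semigroup_identities :: "identity set" where
  "semigroup_identities = {(u, v). u \<noteq> [] \<and> v \<noteq> []}"

text \<open>The value on the empty list is unspecified; it is never used, because identities
  relate nonempty words only.\<close>

fun word_value :: "'u sgrp \<Rightarrow> (nat \<Rightarrow> 'u) \<Rightarrow> word \<Rightarrow> 'u" where
  "word_value S h [x] = h x"
| "word_value S h (x # y # w) = h x \<cdot>\<^bsub>S\<^esub> word_value S h (y # w)"

definition satisfies :: "'u sgrp \<Rightarrow> identity \<Rightarrow> bool" where
  "satisfies S e \<longleftrightarrow>
     (\<forall>h \<in> UNIV \<rightarrow> carrier S. word_value S h (fst e) = word_value S h (snd e))"

text \<open>A class of semigroups is represented by the set of its members whose carrier is a subset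
  of a fixed type \<open>'u\<close>.  For infinite \<open>'u\<close> nothing is lost: the relatively free semigroup of
  countable rank of a variety is countable, hence has a copy inside \<open>'u\<close>, and it determines the
  variety.  So varieties correspond bijectively to their sets of members over \<open>'u\<close>, and the
  correspondence preserves and reflects inclusion.\<close>

definition variety_of :: "identity set \<Rightarrow> 'u sgrp set" where
  "variety_of \<Sigma> = {S. is_semigroup S \<and> (\<forall>e\<in>\<Sigma>. satisfies S e)}"

definition is_variety :: "'u sgrp set \<Rightarrow> bool" where
  "is_variety V \<longleftrightarrow> (\<exists>\<Sigma> \<subseteq> semigroup_identities. V = variety_of \<Sigma>)"

definition variety_satisfies :: "'u sgrp set \<Rightarrow> identity set \<Rightarrow> bool" where
  "variety_satisfies V \<Sigma> \<longleftrightarrow> (\<forall>S\<in>V. \<forall>e\<in>\<Sigma>. satisfies S e)"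

definition commutative_variety :: "'u sgrp set \<Rightarrow> bool" where
  "commutative_variety V \<longleftrightarrow> is_variety V \<and> variety_satisfies V {([0, 1], [1, 0])}"

definition Com :: "'u sgrp set gorder" where
  "Com = \<lparr>carrier = {V. commutative_variety V}, eq = (=), le = (\<subseteq>)\<rparr>"

definition trivial_variety :: "'u sgrp set" where
  "trivial_variety = variety_of {([0], [1])}"

definition semilattice_variety :: "'u sgrp set" where
  "semilattice_variety = variety_of {([0, 0], [0]), ([0, 1], [1, 0])}"

definition COM_variety :: "'u sgrp set" where
  "COM_variety = variety_of {([0, 1], [1, 0])}"

text \<open>The system abbreviated by \<open>w = 0\<close>, i.e. \<open>wx = xw = w\<close> for a letter \<open>x\<close> not occurring in
  \<open>w\<close>; taking all such letters avoids choosing one.\<close>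

definition zero_identity :: "word \<Rightarrow> identity set" where
  "zero_identity w = (\<Union>x \<in> - set w. {(w @ [x], w), (x # w, w)})"

definition modular_element :: "'a gorder \<Rightarrow> 'a \<Rightarrow> bool" where
  "modular_element L x \<longleftrightarrow> x \<in> carrier L \<and>
     (\<forall>y\<in>carrier L. \<forall>z\<in>carrier L. y \<sqsubseteq>\<^bsub>L\<^esub> z \<longrightarrow>
        (x \<squnion>\<^bsub>L\<^esub> y) \<sqinter>\<^bsub>L\<^esub> z = (x \<sqinter>\<^bsub>L\<^esub> z) \<squnion>\<^bsub>L\<^esub> y)"

definition upper_modular_element :: "'a gorder \<Rightarrow> 'a \<Rightarrow> bool" where
  "upper_modular_element L x \<longleftrightarrow> x \<in> carrier L \<and>
     (\<forall>y\<in>carrier L. \<forall>z\<in>carrier L. y \<sqsubseteq>\<^bsub>L\<^esub> x \<longrightarrow>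
        x \<sqinter>\<^bsub>L\<^esub> (y \<squnion>\<^bsub>L\<^esub> z) = y \<squnion>\<^bsub>L\<^esub> (x \<sqinter>\<^bsub>L\<^esub> z))"

definition costandard_element :: "'a gorder \<Rightarrow> 'a \<Rightarrow> bool" where
  "costandard_element L x \<longleftrightarrow> x \<in> carrier L \<and>
     (\<forall>y\<in>carrier L. \<forall>z\<in>carrier L.
        (x \<sqinter>\<^bsub>L\<^esub> y) \<squnion>\<^bsub>L\<^esub> z = (x \<squnion>\<^bsub>L\<^esub> z) \<sqinter>\<^bsub>L\<^esub> (y \<squnion>\<^bsub>L\<^esub> z))"

lemma is_varietyI: "\<Sigma> \<subseteq> semigroup_identities \<Longrightarrow> is_variety (variety_of \<Sigma>)"
  unfolding is_variety_def by (intro exI[of _ \<Sigma>]) simp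

lemma is_varietyE:
  assumes "is_variety V"
  obtains \<Sigma> where "\<Sigma> \<subseteq> semigroup_identities" "V = variety_of \<Sigma>"
  using assms unfolding is_variety_def by auto

lemma is_variety_Int:
  assumes "is_variety V" "is_variety W"
  shows "is_variety (V \<inter> W)"
proof -
  obtain A B where "A \<subseteq> semigroup_identities" "V = variety_of A"
    "B \<subseteq> semigroup_identities" "W = variety_of B"
    using assms by (metis is_varietyE)
  then have "A \<union> B \<subseteq> semigroup_identities" "V \<inter> W = variety_of (A \<union> B)"
    by (auto simp: variety_of_def)
  then show ?thesis by (simp add: is_varietyI)
qed

lemma is_variety_Inter_containing:
  fixes K :: "'u sgrp set"
  assumes "K \<subseteq> {S. is_semigroup S}"
  shows "is_variety (\<Inter>{Z. is_variety Z \<and> K \<subseteq> Z})"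
proof -
  define E where "E = {e \<in> semigroup_identities. \<forall>S\<in>K. satisfies S e}"
  have "\<Inter>{Z. is_variety Z \<and> K \<subseteq> Z} = variety_of E"
  proof (intro subset_antisym)
    have "is_variety (variety_of E :: 'u sgrp set)" "K \<subseteq> variety_of E"
      using assms by (auto intro: is_varietyI simp: E_def) (auto simp: variety_of_def)
    then show "\<Inter>{Z. is_variety Z \<and> K \<subseteq> Z} \<subseteq> variety_of E" by blast
    show "variety_of E \<subseteq> \<Inter>{Z. is_variety Z \<and> K \<subseteq> Z}"
    proof (intro Inter_greatest)
      fix Z assume "Z \<in> {Z. is_variety Z \<and> K \<subseteq> Z}"
      then obtain A where A: "A \<subseteq> semigroup_identities" "Z = variety_of A" "K \<subseteq> Z"
        by (auto elim: is_varietyE)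
      then have "A \<subseteq> E" unfolding E_def variety_of_def by blast
      then show "variety_of E \<subseteq> Z" using A unfolding variety_of_def by blast
    qed
  qed
  moreover have "E \<subseteq> semigroup_identities" by (auto simp: E_def)
  ultimately show ?thesis by (simp add: is_varietyI)
qed

lemma COM_variety_is_variety: "is_variety COM_variety"
  unfolding COM_variety_def by (rule is_varietyI) (simp add: semigroup_identities_def)

lemma commutative_variety_iff: "commutative_variety V \<longleftrightarrow> is_variety V \<and> V \<subseteq> COM_variety"
proof -
  have "V \<subseteq> {S. is_semigroup S}" if "is_variety V"
    using that by (auto elim: is_varietyE simp: variety_of_def)
  then show ?thesis
    by (auto simp: commutative_variety_def variety_satisfies_def COM_variety_def variety_of_def)
qed

lemma Com_partial_order: "partial_order Com"
  by unfold_locales (auto simp: Com_def)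

lemma greatest_Lower_Com:
  assumes "V \<in> carrier Com" "W \<in> carrier Com"
  shows "greatest Com (V \<inter> W) (Lower Com {V, W})"
  using assms is_variety_Int[of V W]
  by (auto simp: Com_def greatest_def Lower_def commutative_variety_iff)

lemma least_Upper_Com:
  assumes "V \<in> carrier Com" "W \<in> carrier Com"
  shows "least Com (\<Inter>{Z. is_variety Z \<and> V \<union> W \<subseteq> Z}) (Upper Com {V, W})"
    (is "least _ ?J _")
proof -
  have "V \<union> W \<subseteq> COM_variety" "V \<union> W \<subseteq> {S. is_semigroup S}"
    using assms by (auto simp: Com_def commutative_variety_iff COM_variety_def variety_of_def)
  then have "commutative_variety ?J"
    unfolding commutative_variety_iff
    using is_variety_Inter_containing COM_variety_is_variety by blast
  then show ?thesis
    using assms by (auto simp: Com_def least_def Upper_def commutative_variety_iff)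
qed

lemma Com_lattice: "lattice (Com :: 'u sgrp set gorder)"
proof -
  interpret partial_order "Com :: 'u sgrp set gorder" by (rule Com_partial_order)
  show ?thesis
  proof unfold_locales
    fix V W :: "'u sgrp set" assume VW: "V \<in> carrier Com" "W \<in> carrier Com"
    show "\<exists>s. least Com s (Upper Com {V, W})" using least_Upper_Com[OF VW] ..
    show "\<exists>s. greatest Com s (Lower Com {V, W})" using greatest_Lower_Com[OF VW] ..
  qed
qed

lemma meet_Com:
  fixes V W :: "'u sgrp set"
  assumes "V \<in> carrier Com" "W \<in> carrier Com"
  shows "V \<sqinter>\<^bsub>Com\<^esub> W = V \<inter> W"
proof -
  interpret partial_order "Com :: 'u sgrp set gorder" by (rule Com_partial_order)
  show ?thesis
    unfolding meet_def inf_def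
    by (metis (no_types, lifting) someI greatest_Lower_Com[OF assms] greatest_unique)
qed

lemma join_Com:
  fixes V W :: "'u sgrp set"
  assumes "V \<in> carrier Com" "W \<in> carrier Com"
  shows "V \<squnion>\<^bsub>Com\<^esub> W = \<Inter>{Z. is_variety Z \<and> V \<union> W \<subseteq> Z}"
proof -
  interpret partial_order "Com :: 'u sgrp set gorder" by (rule Com_partial_order)
  show ?thesis
    unfolding join_def sup_def
    by (metis (no_types, lifting) someI least_Upper_Com[OF assms] least_unique)
qed

end

theory Submission
  imports Defs "HOL-Library.Multiset" "HOL-Library.Countable"
begin

text \<open>
  A commutative variety is the same thing as its equational theory, a fully invariant congruence
  of the free commutative semigroup, and inclusion is reversed (\<open>theory_of_models_of\<close>,
  \<open>theory_of_meet\<close>, \<open>theory_of_join\<close>). So for the theory \<open>\<alpha>\<close> of \<open>V\<close> the claim is that being modular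
  and lower-modular, being standard, and being described by (c) are equivalent. All three turn out
  to say that \<open>\<alpha>\<close> is the equality relation, i.e. \<open>V\<close> is the variety of all commutative semigroups,
  or that \<open>\<alpha>\<close> contains the identity \<open>x\<^sup>2y = xy\<^sup>2\<close>.

  Call a word bulky if it has length at least four and a repeated letter. The basic observation is
  \<open>theory_pair_cases\<close>: in every theory, a word that is not alone in its class equals a bulky
  word, the only exception being a class \<open>{x\<^sup>2y, xy\<^sup>2}\<close>. Moreover \<open>x\<^sup>2y = xy\<^sup>2\<close> implies
  that bulky words of the same content are equal (\<open>bulky_same_content\<close>).

  Suppose \<open>\<alpha>\<close> contains \<open>x\<^sup>2y = xy\<^sup>2\<close>, and let \<open>u = v\<close> hold in \<open>\<gamma>\<close> and in the join of \<open>\<alpha>\<close> and \<open>\<beta>\<close>. Unless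
  \<open>u = v\<close> holds in \<open>\<alpha>\<close>, the observation moves \<open>u\<close> and \<open>v\<close> to bulky words, and \<open>common_bulky\<close> shows that this can be
  done inside \<open>\<alpha> \<inter> \<gamma>\<close> or \<open>\<beta> \<inter> \<gamma>\<close> without changing the content. Bulky words of equal content are
  equal in \<open>\<alpha>\<close>; those of different content are handled by \<open>bulky_all_equal\<close> and \<open>connect_bulky\<close>. Hence
  \<open>\<alpha>\<close> is standard (\<open>swaps_squares_standard\<close>), and standard elements are modular and lower-modular.

  Conversely let \<open>\<alpha>\<close> be nontrivial, modular and lower-modular. Testing lower-modularity against the
  theory of abelian groups of an exponent coprime to the period of \<open>\<alpha>\<close> shows that \<open>x\<^sup>2y\<close> is not
  alone in its class (\<open>lower_modular_moves\<close>). If the class is not \<open>{x\<^sup>2y, xy\<^sup>2}\<close>, then \<open>x\<^sup>2y\<close> equals a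
  bulky word, and testing modularity against theories that collapse all words of length at
  least four gives \<open>x\<^sup>2y = xy\<^sup>2\<close> again (\<open>modular_swaps\<close>).

  Finally, given \<open>x\<^sup>2y = xy\<^sup>2\<close>, the bulky words form a zero if some identity of \<open>V\<close> changes the content,
  and otherwise declaring them to be zero adds only identities that fail in
  semilattices (\<open>content_split\<close>). This is the decomposition in (c).
\<close>

section \<open>Commutative words and their equational theories\<close>

text \<open>Commutative words are nonempty multisets of letters, written additively: \<open>u + v\<close> is the
  product and \<open>repeat_mset n u\<close> the power \<open>u\<^sup>n\<close>.\<close>

definition substitute :: "(nat \<Rightarrow> nat multiset) \<Rightarrow> nat multiset \<Rightarrow> nat multiset" where
  "substitute f u = (\<Sum>x\<in>#u. f x)"

lemma substitute_simps [simp]: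
  "substitute f {#} = {#}"
  "substitute f (add_mset x u) = f x + substitute f u"
  "substitute f (u + v) = substitute f u + substitute f v"
  "substitute f (repeat_mset n u) = repeat_mset n (substitute f u)"
  "substitute f (replicate_mset n x) = repeat_mset n (f x)"
proof -
  show add: "substitute f (u + v) = substitute f u + substitute f v" for u v
    by (simp add: substitute_def)
  show rep: "substitute f (repeat_mset n u) = repeat_mset n (substitute f u)" for u
    by (induction n) (simp_all add: add, simp add: substitute_def)
  show "substitute f (replicate_mset n x) = repeat_mset n (f x)"
    using rep[of "{#x#}"] by (simp add: substitute_def)
qed (simp_all add: substitute_def)

lemma replicate_mset_plus: "replicate_mset (m + n) x = replicate_mset m x + replicate_mset n x"
  by (induction m) simp_all

lemma substitute_nonempty:
  assumes "u \<noteq> {#}" "\<forall>x. f x \<noteq> {#}"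
  shows "substitute f u \<noteq> {#}"
  using assms by (cases u) auto

lemma set_mset_substitute: "set_mset (substitute f u) = (\<Union>x\<in>set_mset u. set_mset (f x))"
  by (induction u) auto

lemma substitute_fresh: "z \<notin># u \<Longrightarrow> substitute ((\<lambda>a. {#a#})(z := t)) u = u"
  by (induction u) auto

lemma substitute_contains: "z \<in># u \<Longrightarrow> f z \<subseteq># substitute f u"
  by (auto dest!: multi_member_split)

text \<open>Two-valued substitutions reduce an arbitrary identity to one between words \<open>X\<^sup>iY\<^sup>j\<close>.\<close>

lemma substitute_const_off:
  "substitute ((\<lambda>a. t)(z := s)) u = repeat_mset (count u z) s + repeat_mset (size u - count u z) t"
proof (induction u)
  case (add a u)
  have "count u z \<le> size u" by (simp add: count_le_size)
  then show ?case using add by (auto simp: Suc_diff_le ac_simps)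
qed simp

lemma size_substitute_ge:
  assumes "\<forall>x. f x \<noteq> {#}"
  shows "size u \<le> size (substitute f u)"
proof (induction u)
  case (add x u)
  have "1 \<le> size (f x)" using assms by (simp add: Suc_le_eq nonempty_has_size)
  then show ?case using add by simp
qed simp

text \<open>A fully invariant congruence of the free commutative semigroup over \<open>nat\<close>: these are the
  equational theories of commutative semigroup varieties.\<close>

definition comm_theory :: "(nat multiset \<times> nat multiset) set \<Rightarrow> bool" where
  "comm_theory \<theta> \<longleftrightarrow> equiv {u. u \<noteq> {#}} \<theta> \<and>
     (\<forall>u v t. (u, v) \<in> \<theta> \<longrightarrow> (u + t, v + t) \<in> \<theta>) \<and>
     (\<forall>u v f. (u, v) \<in> \<theta> \<longrightarrow> (\<forall>x. f x \<noteq> {#}) \<longrightarrow> (substitute f u, substitute f v) \<in> \<theta>)"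

lemma comm_theoryI:
  assumes "\<And>u v. (u, v) \<in> \<theta> \<Longrightarrow> u \<noteq> {#} \<and> v \<noteq> {#}"
    and "\<And>u. u \<noteq> {#} \<Longrightarrow> (u, u) \<in> \<theta>"
    and "\<And>u v. (u, v) \<in> \<theta> \<Longrightarrow> (v, u) \<in> \<theta>"
    and "\<And>u v w. (u, v) \<in> \<theta> \<Longrightarrow> (v, w) \<in> \<theta> \<Longrightarrow> (u, w) \<in> \<theta>"
    and "\<And>u v t. (u, v) \<in> \<theta> \<Longrightarrow> (u + t, v + t) \<in> \<theta>"
    and "\<And>u v f. (u, v) \<in> \<theta> \<Longrightarrow> \<forall>x. f x \<noteq> {#} \<Longrightarrow> (substitute f u, substitute f v) \<in> \<theta>"
  shows "comm_theory \<theta>"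
  unfolding comm_theory_def
proof (intro conjI allI impI equivI)
  show "\<theta> \<subseteq> {u. u \<noteq> {#}} \<times> {u. u \<noteq> {#}}" using assms(1) by auto
  show "refl_on {u. u \<noteq> {#}} \<theta>" using assms(1,2) by (auto simp: refl_on_def)
  show "sym \<theta>" using assms(3) by (auto simp: sym_def)
  show "trans \<theta>" using assms(4) by (blast intro: transI)
qed (rule assms(5), assumption, rule assms(6), assumption, blast)

context
  fixes \<theta> :: "(nat multiset \<times> nat multiset) set"
  assumes \<theta>: "comm_theory \<theta>"
begin

lemma theory_refl: "u \<noteq> {#} \<Longrightarrow> (u, u) \<in> \<theta>"
  using \<theta> by (auto simp: comm_theory_def equiv_def refl_on_def)

lemma theory_sym: "(u, v) \<in> \<theta> \<Longrightarrow> (v, u) \<in> \<theta>"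
  using \<theta> by (auto simp: comm_theory_def equiv_def sym_def)

lemma theory_trans: "(u, v) \<in> \<theta> \<Longrightarrow> (v, w) \<in> \<theta> \<Longrightarrow> (u, w) \<in> \<theta>"
  using \<theta> by (auto simp: comm_theory_def equiv_def intro: transD)

lemma theory_nonempty: "(u, v) \<in> \<theta> \<Longrightarrow> u \<noteq> {#} \<and> v \<noteq> {#}"
  using \<theta> by (auto simp: comm_theory_def equiv_def)

lemma theory_add: "(u, v) \<in> \<theta> \<Longrightarrow> (u + t, v + t) \<in> \<theta>"
  using \<theta> by (auto simp: comm_theory_def)

lemma theory_substitute:
  "(u, v) \<in> \<theta> \<Longrightarrow> (\<And>x. f x \<noteq> {#}) \<Longrightarrow> (substitute f u, substitute f v) \<in> \<theta>"
  using \<theta> by (auto simp: comm_theory_def)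

lemma theory_iterate:
  assumes "(u, u + w) \<in> \<theta>"
  shows "(u, u + repeat_mset k w) \<in> \<theta>"
proof (induction k)
  case 0
  then show ?case using theory_refl[of u] theory_nonempty[OF assms] by simp
next
  case (Suc k)
  have "(u + w, u + repeat_mset k w + w) \<in> \<theta>" by (rule theory_add[OF Suc])
  then have "(u, u + repeat_mset k w + w) \<in> \<theta>" by (rule theory_trans[OF assms])
  then show ?case by (simp add: ac_simps)
qed

text \<open>Mapping every letter to \<open>x\<close> makes high powers of \<open>x\<close> periodic with period the length of
  \<open>w\<close>, and enough copies of \<open>w\<close> supply such a power.\<close>

lemma theory_absorbs_letter:
  assumes "(u, u + w) \<in> \<theta>" "x \<in># w"
  shows "\<exists>s\<ge>1. (u, u + replicate_mset s x) \<in> \<theta>"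
proof -
  have "(substitute (\<lambda>_. {#x#}) u, substitute (\<lambda>_. {#x#}) (u + w)) \<in> \<theta>"
    by (rule theory_substitute[OF assms(1)]) simp
  moreover have "substitute (\<lambda>_. {#x#}) v = replicate_mset (size v) x" for v
    by (induction v) auto
  ultimately have per:
    "(replicate_mset (size u) x, replicate_mset (size u) x + replicate_mset (size w) x) \<in> \<theta>"
    by (simp add: replicate_mset_plus)
  obtain w' where w': "w = add_mset x w'" using assms(2) by (blast dest: multi_member_split)
  define t where "t = u + repeat_mset (size u) w'"
  have ut: "u + repeat_mset (size u) w = replicate_mset (size u) x + t"
    by (simp add: w' t_def ac_simps)
  have k: "(u, replicate_mset (size u) x + t) \<in> \<theta>"
    using theory_iterate[OF assms(1), of "size u"] ut by simp
  have "(replicate_mset (size u) x + t, replicate_mset (size u) x + replicate_mset (size w) x + t) \<in> \<theta>"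
    by (rule theory_add[OF per])
  moreover have "(replicate_mset (size u) x + replicate_mset (size w) x + t, u + replicate_mset (size w) x) \<in> \<theta>"
    using theory_sym[OF theory_add[OF k, of "replicate_mset (size w) x"]] by (simp add: ac_simps)
  ultimately have "(u, u + replicate_mset (size w) x) \<in> \<theta>"
    using theory_trans[OF k] theory_trans by blast
  moreover have "size w \<ge> 1" by (simp add: w')
  ultimately show ?thesis by blast
qed

end

text \<open>Reflexivity is inherited from either argument, so the transitive closure suffices.\<close>

definition join_theory :: "(nat multiset \<times> nat multiset) set \<Rightarrow> (nat multiset \<times> nat multiset) set
    \<Rightarrow> (nat multiset \<times> nat multiset) set" where
  "join_theory \<alpha> \<beta> = (\<alpha> \<union> \<beta>)\<^sup>+"

lemma comm_theory_Int:
  assumes "comm_theory \<alpha>" "comm_theory \<beta>"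
  shows "comm_theory (\<alpha> \<inter> \<beta>)"
proof (rule comm_theoryI)
  show "(u, w) \<in> \<alpha> \<inter> \<beta>" if "(u, v) \<in> \<alpha> \<inter> \<beta>" "(v, w) \<in> \<alpha> \<inter> \<beta>" for u v w
    using theory_trans[OF assms(1), of u v w] theory_trans[OF assms(2), of u v w] that by simp
  show "u \<noteq> {#} \<and> v \<noteq> {#}" if "(u, v) \<in> \<alpha> \<inter> \<beta>" for u v
    using theory_nonempty[OF assms(1), of u v] that by blast
  show "(v, u) \<in> \<alpha> \<inter> \<beta>" if "(u, v) \<in> \<alpha> \<inter> \<beta>" for u v
    using theory_sym[OF assms(1), of u v] theory_sym[OF assms(2), of u v] that by blast
next
  show "(u + t, v + t) \<in> \<alpha> \<inter> \<beta>" if "(u, v) \<in> \<alpha> \<inter> \<beta>" for u v t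
    using theory_add[OF assms(1), of u v] theory_add[OF assms(2), of u v] that by blast
  show "(substitute f u, substitute f v) \<in> \<alpha> \<inter> \<beta>"
    if "(u, v) \<in> \<alpha> \<inter> \<beta>" "\<forall>x. f x \<noteq> {#}" for u v f
    using theory_substitute[OF assms(1), of u v f] theory_substitute[OF assms(2), of u v f] that
    by blast
  show "(u, u) \<in> \<alpha> \<inter> \<beta>" if "u \<noteq> {#}" for u
    using theory_refl[OF assms(1) that] theory_refl[OF assms(2) that] by blast
qed

lemma trancl_map:
  assumes "(u, v) \<in> R\<^sup>+" "\<And>u v. (u, v) \<in> R \<Longrightarrow> (f u, f v) \<in> R"
  shows "(f u, f v) \<in> R\<^sup>+"
  using assms(1)
proof induction
  case (base y)
  then show ?case using assms(2) by blast
next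
  case (step y z)
  then show ?case using assms(2)[OF step(2)] trancl_into_trancl[of "f u" "f y" R "f z"] by simp
qed

lemma trancl_stays:
  assumes "(u, v) \<in> R\<^sup>+" "u \<in> A" "\<And>u v. (u, v) \<in> R \<Longrightarrow> u \<in> A \<Longrightarrow> v \<in> A"
  shows "v \<in> A"
  using assms(1)
proof induction
  case (base y)
  then show ?case using assms(3)[OF base assms(2)] by simp
next
  case (step y z)
  then show ?case using assms(3)[OF step(2) step.IH] by simp
qed

lemma comm_theory_join:
  assumes "comm_theory \<alpha>" "comm_theory \<beta>"
  shows "comm_theory (join_theory \<alpha> \<beta>)"
  unfolding join_theory_def
proof (rule comm_theoryI)
  let ?R = "\<alpha> \<union> \<beta>"
  have R: "u \<noteq> {#} \<and> v \<noteq> {#} \<and> (v, u) \<in> ?R" if "(u, v) \<in> ?R" for u v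
    using that theory_nonempty[OF assms(1), of u v] theory_nonempty[OF assms(2), of u v]
      theory_sym[OF assms(1), of u v] theory_sym[OF assms(2), of u v] by blast
  have add: "(u + t, v + t) \<in> ?R" if "(u, v) \<in> ?R" for u v t
    using that theory_add[OF assms(1), of u v] theory_add[OF assms(2), of u v] by blast
  have sub: "(substitute f u, substitute f v) \<in> ?R" if "(u, v) \<in> ?R" "\<forall>x. f x \<noteq> {#}" for u v f
    using that theory_substitute[OF assms(1), of u v f] theory_substitute[OF assms(2), of u v f]
    by blast
  fix u v assume uv: "(u, v) \<in> ?R\<^sup>+"
  show "u \<noteq> {#} \<and> v \<noteq> {#}"
    using tranclD[OF uv] tranclD2[OF uv] R by blast
  show "(v, u) \<in> ?R\<^sup>+"
    using uv
  proof induction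
    case (base y)
    then show ?case using R by blast
  next
    case (step y z)
    then have "(z, y) \<in> ?R" using R by blast
    then show ?case using step(3) by (rule trancl_into_trancl2)
  qed
  show "(u + t, v + t) \<in> ?R\<^sup>+" for t
    using uv by (rule trancl_map) (rule add)
  show "(substitute f u, substitute f v) \<in> ?R\<^sup>+" if "\<forall>x. f x \<noteq> {#}" for f
    using uv by (rule trancl_map) (rule sub[OF _ that])
next
  show "(u, u) \<in> (\<alpha> \<union> \<beta>)\<^sup>+" if "u \<noteq> {#}" for u
    using theory_refl[OF assms(1) that] by blast
qed (rule trancl_trans)

lemma join_theory_upper: "\<alpha> \<subseteq> join_theory \<alpha> \<beta>" "\<beta> \<subseteq> join_theory \<alpha> \<beta>"
  by (auto simp: join_theory_def)

lemma join_theory_least: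
  assumes "comm_theory \<gamma>" "\<alpha> \<subseteq> \<gamma>" "\<beta> \<subseteq> \<gamma>"
  shows "join_theory \<alpha> \<beta> \<subseteq> \<gamma>"
proof -
  have "trans \<gamma>" using assms(1) by (auto simp: comm_theory_def equiv_def)
  then have "\<gamma>\<^sup>+ = \<gamma>" by (rule trancl_id)
  then show ?thesis
    unfolding join_theory_def using trancl_mono_subset[of "\<alpha> \<union> \<beta>" \<gamma>] assms by auto
qed

section \<open>Long words with a repeated letter\<close>

text \<open>The values of \<open>x\<^sup>2yz\<close>: the words that vanish in every variety satisfying \<open>x\<^sup>2yz = 0\<close>.\<close>

definition bulky :: "nat multiset \<Rightarrow> bool" where
  "bulky u \<longleftrightarrow> 4 \<le> size u \<and> (\<exists>x. 2 \<le> count u x)"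

lemma bulky_nonempty: "bulky u \<Longrightarrow> u \<noteq> {#}"
  by (auto simp: bulky_def)

lemma bulky_mono:
  assumes "bulky u" "u \<subseteq># v"
  shows "bulky v"
proof -
  obtain x where "2 \<le> count u x" using assms(1) by (auto simp: bulky_def)
  then have "2 \<le> count v x" using mset_subset_eq_count[OF assms(2), of x] by linarith
  then show ?thesis
    using assms(1) size_mset_mono[OF assms(2)] unfolding bulky_def by fastforce
qed

lemma bulky_add: "bulky u \<Longrightarrow> bulky (u + t)"
  by (erule bulky_mono) simp

lemma bulky_repeat: "t \<noteq> {#} \<Longrightarrow> 4 \<le> k \<Longrightarrow> bulky (repeat_mset k t)"
proof -
  assume t: "t \<noteq> {#}" "4 \<le> k"
  then obtain x where "x \<in># t" by auto
  then have "1 \<le> count t x" by (simp add: Suc_le_eq)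
  then have "4 * 1 \<le> k * count t x" using t by (intro mult_le_mono) auto
  moreover have "1 \<le> size t" using t by (simp add: Suc_le_eq nonempty_has_size)
  then have "4 * 1 \<le> k * size t" using t by (intro mult_le_mono) auto
  ultimately show ?thesis by (auto simp: bulky_def intro!: exI[of _ x])
qed

lemma bulky_substitute:
  assumes "bulky u" "\<forall>x. f x \<noteq> {#}"
  shows "bulky (substitute f u)"
proof -
  obtain x where x: "2 \<le> count u x" using assms(1) by (auto simp: bulky_def)
  obtain y where "y \<in># f x" using assms(2) by (meson multiset_nonemptyE)
  then have y: "1 \<le> count (f x) y" by (simp add: Suc_le_eq)
  have "replicate_mset 2 x \<subseteq># u" using x by (simp add: count_le_replicate_mset_subset_eq)
  then obtain t where "u = replicate_mset 2 x + t" by (metis subset_mset.le_iff_add)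
  then have "count (substitute f u) y = 2 * count (f x) y + count (substitute f t) y" by simp
  then have "2 \<le> count (substitute f u) y" using y by linarith
  then show ?thesis
    using assms(1) size_substitute_ge[OF assms(2), of u] by (auto simp: bulky_def)
qed

lemma non_bulky_cases:
  assumes "u \<noteq> {#}" "\<not> bulky u"
  obtains (linear) "\<forall>x. count u x \<le> 1"
    | (square) x where "u = {#x, x#}"
    | (cube) x where "u = {#x, x, x#}"
    | (square_letter) x y where "x \<noteq> y" "u = {#x, x, y#}"
proof (cases "\<forall>x. count u x \<le> 1")
  case False
  then obtain x where "\<not> count u x \<le> 1" by blast
  then have x: "2 \<le> count u x" by simp
  then have "size u \<le> 3" using assms by (auto simp: bulky_def)
  have "replicate_mset 2 x \<subseteq># u" using x by (simp add: count_le_replicate_mset_subset_eq)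
  then obtain t where t: "u = replicate_mset 2 x + t" by (metis subset_mset.le_iff_add)
  with \<open>size u \<le> 3\<close> have "size t \<le> 1" by simp
  then have "t = {#} \<or> size t = 1" by (cases t) auto
  then consider "t = {#}" | y where "t = {#y#}"
    using size_1_singleton_mset by blast
  then show ?thesis
  proof cases
    case 1
    then show ?thesis using t that(2) by (simp add: numeral_2_eq_2)
  next
    case (2 y)
    then show ?thesis
      using t that(3)[of x] that(4)[of x y] by (cases "x = y") (auto simp: numeral_2_eq_2)
  qed
qed (use that in blast)

section \<open>Nontrivial classes of a theory\<close>

definition reaches_bulky :: "(nat multiset \<times> nat multiset) set \<Rightarrow> nat multiset \<Rightarrow> bool" where
  "reaches_bulky \<theta> u \<longleftrightarrow> (\<exists>i. bulky i \<and> (u, i) \<in> \<theta>)"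

lemma bulky_reaches:
  assumes "comm_theory \<theta>" "bulky u"
  shows "reaches_bulky \<theta> u"
  unfolding reaches_bulky_def using theory_refl[OF assms(1) bulky_nonempty] assms(2) by blast

lemma reaches_bulky_trans:
  assumes "comm_theory \<theta>" "(u, v) \<in> \<theta>" "reaches_bulky \<theta> v"
  shows "reaches_bulky \<theta> u"
  using assms(3) theory_trans[OF assms(1,2)] unfolding reaches_bulky_def by blast

lemma reaches_bulky_substitute:
  assumes "comm_theory \<theta>" "reaches_bulky \<theta> u" "\<And>x. f x \<noteq> {#}"
  shows "reaches_bulky \<theta> (substitute f u)"
proof -
  obtain i where "bulky i" "(u, i) \<in> \<theta>" using assms(2) by (auto simp: reaches_bulky_def)
  then show ?thesis
    using bulky_substitute[of i f] theory_substitute[OF assms(1), of u i f] assms(3)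
    unfolding reaches_bulky_def by blast
qed

text \<open>Iterating \<open>u = ut\<close> puts four copies of \<open>t\<close> into the class of \<open>u\<close>.\<close>

lemma reaches_bulky_subset:
  assumes "comm_theory \<theta>" "(u, v) \<in> \<theta>" "u \<subset># v"
  shows "reaches_bulky \<theta> u"
proof -
  obtain t where t: "v = u + t" "t \<noteq> {#}"
    using assms(3) by (metis add.right_neutral subset_mset.le_iff_add subset_mset.less_le)
  have "(u, u + repeat_mset 4 t) \<in> \<theta>"
    using theory_iterate[OF assms(1)] assms(2) t(1) by blast
  moreover have "bulky (u + repeat_mset 4 t)"
    using bulky_add[OF bulky_repeat[OF t(2), of 4], of u] by (simp add: ac_simps)
  ultimately show ?thesis unfolding reaches_bulky_def by blast
qed

text \<open>A letter absent from \<open>v\<close> may be replaced by its fourth power without changing \<open>v\<close>.\<close>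

lemma reaches_bulky_content:
  assumes "comm_theory \<theta>" "(u, v) \<in> \<theta>" "z \<in># u" "z \<notin># v"
  shows "reaches_bulky \<theta> u"
proof -
  define f where "f = (\<lambda>a. {#a#})(z := repeat_mset 4 {#z#})"
  have f: "f x \<noteq> {#}" for x by (simp add: f_def)
  have "(substitute f u, substitute f v) \<in> \<theta>"
    by (rule theory_substitute[OF assms(1,2)]) (rule f)
  then have "(substitute f u, v) \<in> \<theta>"
    by (simp add: f_def substitute_fresh[OF assms(4)])
  then have "(u, substitute f u) \<in> \<theta>"
    using assms(1,2) theory_sym theory_trans by blast
  moreover have "bulky (substitute f u)"
    using bulky_repeat[of "{#z#}" 4] substitute_contains[OF assms(3), of f] bulky_mono
    by (simp add: f_def)
  ultimately show ?thesis unfolding reaches_bulky_def by blast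
qed

text \<open>The dichotomy behind the whole proof. An identity that changes the content or that compares a
  word with a proper multiple of it leads to bulky words; among the words that are not bulky, the
  only pairs left are \<open>x\<^sup>2y\<close> and \<open>xy\<^sup>2\<close>.\<close>

lemma theory_pair_cases:
  assumes \<theta>: "comm_theory \<theta>" and uv: "(u, v) \<in> \<theta>" "u \<noteq> v"
  shows "reaches_bulky \<theta> u \<or> (\<exists>x y. x \<noteq> y \<and> u = {#x, x, y#} \<and> v = {#x, y, y#})"
proof (rule ccontr)
  assume contra: "\<not> ?thesis"
  have vu: "(v, u) \<in> \<theta>" by (rule theory_sym[OF \<theta> uv(1)])
  have no: "\<not> reaches_bulky \<theta> u" "\<not> reaches_bulky \<theta> v"
    using contra reaches_bulky_trans[OF \<theta> uv(1)] by blast+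
  then have nb: "\<not> bulky u" "\<not> bulky v" using bulky_reaches[OF \<theta>] by blast+
  have ne: "u \<noteq> {#}" "v \<noteq> {#}" using theory_nonempty[OF \<theta> uv(1)] by auto
  have eq: "set_mset u = set_mset v"
    using reaches_bulky_content[OF \<theta> uv(1)] reaches_bulky_content[OF \<theta> vu] no by blast
  have inc: "\<not> u \<subset># v" "\<not> v \<subset># u"
    using reaches_bulky_subset[OF \<theta> uv(1)] reaches_bulky_subset[OF \<theta> vu] no by blast+
  have linsub: "u' \<subset># v'" if "\<forall>x. count u' x \<le> 1" "set_mset u' = set_mset v'" "u' \<noteq> v'"
    for u' v' :: "nat multiset"
  proof -
    have "count u' x \<le> count v' x" for x
    proof (cases "x \<in># u'")
      case True
      then have "x \<in># v'" using that(2) by blast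
      then have "1 \<le> count v' x" by (simp add: Suc_le_eq)
      then show ?thesis using that(1) le_trans by blast
    qed (simp add: not_in_iff)
    then show ?thesis using that(3) by (simp add: subseteq_mset_def subset_mset.less_le)
  qed
  have nl: "\<not> (\<forall>x. count u x \<le> 1)" "\<not> (\<forall>x. count v x \<le> 1)"
    using linsub[of u v] linsub[of v u] eq inc uv(2) by (blast, metis)
  have noP: False if "x \<noteq> y" "u = {#x, x, y#}" "v = {#x, y, y#}" for x y
    using contra that by blast
  have mono: "{#x, x#} \<subset># {#x, x, x#}" for x :: nat
    by simp
  have powers: False
    if u: "u = {#x, x#} \<or> u = {#x, x, x#} \<or> (\<exists>b. b \<noteq> x \<and> u = {#x, x, b#})"
      and v: "v = {#y, y#} \<or> v = {#y, y, y#} \<or> (\<exists>c. c \<noteq> y \<and> v = {#y, y, c#})" for x y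
  proof (cases "\<exists>b. b \<noteq> x \<and> u = {#x, x, b#}")
    case True
    then obtain b where b: "b \<noteq> x" "u = {#x, x, b#}" by blast
    then have "set_mset v = {x, b}" using eq by simp
    then obtain c where c: "c \<noteq> y" "v = {#y, y, c#}" using v b(1) by auto
    then have "{x, b} = {y, c}" using \<open>set_mset v = {x, b}\<close> by simp
    then consider "x = y" "b = c" | "x = c" "b = y" by (auto simp: doubleton_eq_iff)
    then show False
    proof cases
      case 1
      then show False using b c uv(2) by simp
    next
      case 2
      then have "v = {#x, b, b#}" using c(2) by (simp add: add_mset_commute)
      then show False using noP b by metis
    qed
  next
    case False
    then have u': "u = {#x, x#} \<or> u = {#x, x, x#}" using u by blast
    then have "set_mset u = {x}" by auto
    then have "set_mset v = {x}" using eq by simp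
    then have "v = {#x, x#} \<or> v = {#x, x, x#}" using v by auto
    then show False using u' uv(2) inc mono by metis
  qed
  have shape: "\<exists>x. w = {#x, x#} \<or> w = {#x, x, x#} \<or> (\<exists>y. y \<noteq> x \<and> w = {#x, x, y#})"
    if w: "w \<noteq> {#}" "\<not> bulky w" "\<not> (\<forall>x. count w x \<le> 1)" for w
    using w(1,2)
  proof (cases rule: non_bulky_cases)
    case linear
    then show ?thesis using w(3) by blast
  next
    case (square x)
    then show ?thesis by blast
  next
    case (cube x)
    then show ?thesis by blast
  next
    case (square_letter x y)
    then show ?thesis by metis
  qed
  show False
    using shape[OF ne(1) nb(1) nl(1)] shape[OF ne(2) nb(2) nl(2)] powers by (elim exE) iprover
qed

lemma substitute_attach:
  "substitute ((\<lambda>a. {#a#})(z := {#z, x#})) u = u + replicate_mset (count u z) x"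
  by (induction u) auto

lemma substitute_fixed:
  assumes "\<And>a. a \<in># u \<Longrightarrow> f a = {#a#}"
  shows "substitute f u = u"
  using assms by (induction u) auto

text \<open>Letters of \<open>i\<close> outside \<open>u\<close> can be identified with \<open>x\<close>. If a letter \<open>z\<close> of \<open>u\<close> is then still
  missing from \<open>i\<close>, substituting \<open>zx\<close> for \<open>z\<close> fixes \<open>i\<close> and multiplies \<open>u\<close> by a power of \<open>x\<close>.\<close>

lemma reaches_bulky_same_content:
  assumes \<theta>: "comm_theory \<theta>" and "reaches_bulky \<theta> u" "x \<in># u"
  shows "(\<exists>s\<ge>1. (u, u + replicate_mset s x) \<in> \<theta>) \<or>
    (\<exists>i. bulky i \<and> set_mset i = set_mset u \<and> (u, i) \<in> \<theta>)"
proof -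
  obtain i where i: "bulky i" "(u, i) \<in> \<theta>" using assms(2) by (auto simp: reaches_bulky_def)
  define f where "f = (\<lambda>a. if a \<in># u then {#a#} else {#x#})"
  have f: "f a \<noteq> {#}" for a by (simp add: f_def)
  define i' where "i' = substitute f i"
  have "substitute f u = u" by (rule substitute_fixed) (simp add: f_def)
  moreover have "(substitute f u, substitute f i) \<in> \<theta>"
    by (rule theory_substitute[OF \<theta> i(2)]) (rule f)
  ultimately have ui': "(u, i') \<in> \<theta>" by (simp add: i'_def)
  have b: "bulky i'" using bulky_substitute[OF i(1)] f by (simp add: i'_def)
  have sub: "set_mset i' \<subseteq> set_mset u"
    using assms(3) by (auto simp: i'_def set_mset_substitute f_def split: if_splits)
  show ?thesis
  proof (cases "set_mset i' = set_mset u")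
    case False
    then obtain z where z: "z \<in># u" "z \<notin># i'" using sub by blast
    define g where "g = (\<lambda>a. {#a#})(z := {#z, x#})"
    have "(substitute g u, substitute g i') \<in> \<theta>"
      by (rule theory_substitute[OF \<theta> ui']) (simp add: g_def)
    then have "(u + replicate_mset (count u z) x, i') \<in> \<theta>"
      using substitute_attach[of z x u] substitute_fresh[OF z(2)] by (simp add: g_def)
    then have "(u, u + replicate_mset (count u z) x) \<in> \<theta>"
      using theory_trans[OF \<theta> ui' theory_sym[OF \<theta>]] by blast
    moreover have "1 \<le> count u z" using z(1) by (simp add: Suc_le_eq)
    ultimately show ?thesis by blast
  qed (use b ui' in blast)
qed

text \<open>In a linear word all letters are interchangeable, so a letter gained by \<open>u = uw\<close> can be moved
  to \<open>x\<close> by a transposition that fixes \<open>u\<close>.\<close>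

lemma anchor_letter_linear:
  assumes \<theta>: "comm_theory \<theta>" and "reaches_bulky \<theta> u"
    and lin: "\<forall>a. count u a \<le> 1" and x: "x \<in># u"
  shows "\<exists>s\<ge>1. (u, u + replicate_mset s x) \<in> \<theta>"
proof (rule ccontr)
  assume contra: "\<not> ?thesis"
  then obtain i where i: "bulky i" "set_mset i = set_mset u" "(u, i) \<in> \<theta>"
    using reaches_bulky_same_content[OF \<theta> assms(2) x] by blast
  have "count u a \<le> count i a" for a
  proof (cases "a \<in># u")
    case True
    then have "a \<in># i" using i(2) by blast
    then have "1 \<le> count i a" by (simp add: Suc_le_eq)
    then show ?thesis using lin le_trans by blast
  qed (simp add: not_in_iff)
  then have "u \<subseteq># i" by (simp add: subseteq_mset_def)
  then obtain w where w: "i = u + w" by (metis subset_mset.le_iff_add)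
  obtain c where "2 \<le> count i c" using i(1) by (auto simp: bulky_def)
  then have "\<not> count i c \<le> 1" by linarith
  then have "u \<noteq> i" using spec[OF lin, of c] by metis
  then obtain y where y: "y \<in># w" using w by auto
  have "y \<in># u" using y i(2) w by auto
  have "x \<noteq> y" using contra theory_absorbs_letter[OF \<theta>, of u w x] i(3) w y by blast
  define f where "f = (\<lambda>a. {#if a = x then y else if a = y then x else a#})"
  obtain u1 where u1: "u = add_mset x u1" using x by (blast dest: multi_member_split)
  then have "y \<in># u1" using \<open>y \<in># u\<close> \<open>x \<noteq> y\<close> by simp
  then obtain u2 where u2: "u = {#x, y#} + u2"
    using u1 by (auto dest!: multi_member_split)
  have "count u x \<le> 1" "count u y \<le> 1" using lin by auto
  then have "x \<notin># u2" "y \<notin># u2" using u2 \<open>x \<noteq> y\<close> by (auto simp: not_in_iff)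
  then have "substitute f u2 = u2" by (intro substitute_fixed) (auto simp: f_def)
  then have fu: "substitute f u = u" using u2 by (simp add: f_def add_mset_commute)
  have "(substitute f u, substitute f i) \<in> \<theta>"
    by (rule theory_substitute[OF \<theta> i(3)]) (simp add: f_def)
  then have "(u, u + substitute f w) \<in> \<theta>" by (simp add: fu w)
  moreover have "x \<in># substitute f w"
    using y by (auto simp: set_mset_substitute f_def intro!: bexI[of _ y])
  ultimately show False using contra theory_absorbs_letter[OF \<theta>] by blast
qed

lemma anchor_letter_power:
  assumes \<theta>: "comm_theory \<theta>" and "reaches_bulky \<theta> u"
    and u: "u = replicate_mset m x" "1 \<le> m" "m \<le> 3"
  shows "\<exists>s\<ge>1. (u, u + replicate_mset s x) \<in> \<theta>"
proof (rule ccontr)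
  assume contra: "\<not> ?thesis"
  have "x \<in># u" using u by simp
  then obtain i where i: "bulky i" "set_mset i = set_mset u" "(u, i) \<in> \<theta>"
    using reaches_bulky_same_content[OF \<theta> assms(2)] contra by blast
  have "set_mset i \<subseteq> {x}" using i(2) u by auto
  then have "i = replicate_mset (size i) x" by (rule set_mset_subset_singletonD)
  moreover have "size i = m + (size i - m)" using i(1) u by (simp add: bulky_def)
  ultimately have "i = u + replicate_mset (size i - m) x"
    using u(1) replicate_mset_plus[of m "size i - m" x] by simp
  moreover have "4 \<le> size i" using i(1) by (simp add: bulky_def)
  then have "1 \<le> size i - m" using u(3) by linarith
  ultimately show False using contra i(3) by metis
qed

text \<open>Only the squared letter can serve here: from \<open>x\<^sup>2y = x\<^sup>3y\<close> one never gains a further \<open>y\<close>.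
  If the identity does not already raise the power of \<open>x\<close>, rereading its right-hand
  side as another value of \<open>x\<^sup>2y\<close>, or exchanging \<open>x\<close> and \<open>y\<close>, produces one that does.\<close>

lemma anchor_letter_square_letter:
  assumes \<theta>: "comm_theory \<theta>" and "reaches_bulky \<theta> u"
    and u: "u = {#x, x, y#}" and xy: "x \<noteq> y"
  shows "\<exists>s\<ge>1. (u, u + replicate_mset s x) \<in> \<theta>"
proof (rule ccontr)
  assume contra: "\<not> ?thesis"
  have absorb: False if "(u, u + w) \<in> \<theta>" "x \<in># w" for w
    using contra theory_absorbs_letter[OF \<theta> that] by blast
  have "x \<in># u" using u by simp
  then obtain i where i: "bulky i" "set_mset i = set_mset u" "(u, i) \<in> \<theta>"
    using reaches_bulky_same_content[OF \<theta> assms(2)] contra by blast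
  define a b where "a = count i x" and "b = count i y"
  have "x \<in># i" "y \<in># i" using i(2) u by auto
  then have ab: "1 \<le> a" "1 \<le> b" by (simp_all add: a_def b_def Suc_le_eq)
  have iab: "i = replicate_mset a x + replicate_mset b y"
  proof (rule multiset_eqI)
    fix z
    have "z \<noteq> x \<Longrightarrow> z \<noteq> y \<Longrightarrow> z \<notin># i" using i(2) u by auto
    then show "count i z = count (replicate_mset a x + replicate_mset b y) z"
      using xy by (auto simp: a_def b_def not_in_iff)
  qed
  have size: "4 \<le> a + b" using i(1) iab by (simp add: bulky_def)
  consider "3 \<le> a" | "a = 2" | "a = 1" using ab by linarith
  then show False
  proof cases
    case 1
    have "i = u + (replicate_mset (a - 2) x + replicate_mset (b - 1) y)"
      unfolding iab u using 1 ab xy by (intro multiset_eqI) auto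
    then show False using absorb i(3) 1 by (metis in_replicate_mset union_iff zero_less_diff
          less_le_trans numeral_2_eq_2 numeral_3_eq_3 lessI not_gr_zero)
  next
    case 2
    \<comment> \<open>\<open>x\<^sup>2y\<^sup>b\<close> is the value of \<open>x\<^sup>2y\<close> at \<open>y\<close> and \<open>x\<^sup>2y\<^sup>c\<close>, where \<open>c = b - 2\<close>.\<close>
    define f where "f = (\<lambda>c. {#c#})(x := {#y#}, y := replicate_mset 2 x + replicate_mset (b - 2) y)"
    have "(substitute f u, substitute f i) \<in> \<theta>"
      by (rule theory_substitute[OF \<theta> i(3)]) (simp add: f_def)
    moreover have "substitute f u = i"
      unfolding iab u using 2 size xy by (intro multiset_eqI) (auto simp: f_def)
    moreover have "substitute f i = u + (replicate_mset (2 * b - 2) x + replicate_mset (1 + b * (b - 2)) y)"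
      unfolding iab u using 2 size xy by (intro multiset_eqI) (auto simp: f_def)
    ultimately have "(u, u + (replicate_mset (2 * b - 2) x + replicate_mset (1 + b * (b - 2)) y)) \<in> \<theta>"
      using theory_trans[OF \<theta> i(3)] by simp
    moreover have "x \<in># replicate_mset (2 * b - 2) x + replicate_mset (1 + b * (b - 2)) y"
      using size 2 by simp
    ultimately show False by (rule absorb)
  next
    case 3
    define f where "f = (\<lambda>c. {#c#})(x := {#y#}, y := {#x#})"
    \<comment> \<open>Exchange the letters in \<open>x\<^sup>2y = xy\<^sup>b\<close> and multiply by \<open>y\<^sup>c\<close>, \<open>c = b - 2\<close>: then \<open>xy\<^sup>b = x\<^sup>by\<^sup>c\<^sup>+\<^sup>1\<close>.\<close>
    have "(substitute f u + replicate_mset (b - 2) y, substitute f i + replicate_mset (b - 2) y) \<in> \<theta>"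
      by (rule theory_add[OF \<theta>], rule theory_substitute[OF \<theta> i(3)]) (simp add: f_def)
    moreover have "substitute f u + replicate_mset (b - 2) y = i"
      unfolding iab u using 3 size xy by (intro multiset_eqI) (auto simp: f_def)
    moreover have "substitute f i + replicate_mset (b - 2) y
        = u + (replicate_mset (b - 2) x + replicate_mset (b - 2) y)"
      unfolding iab u using 3 size xy by (intro multiset_eqI) (auto simp: f_def)
    ultimately have "(u, u + (replicate_mset (b - 2) x + replicate_mset (b - 2) y)) \<in> \<theta>"
      using theory_trans[OF \<theta> i(3)] by simp
    moreover have "x \<in># replicate_mset (b - 2) x + replicate_mset (b - 2) y" using size 3 by simp
    ultimately show False by (rule absorb)
  qed
qed

text \<open>The letter \<open>x\<close> depends on \<open>u\<close> alone and not on the theory. This uniformity lets two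
  theories be treated simultaneously.\<close>

lemma anchor_letter:
  assumes "u \<noteq> {#}" "\<not> bulky u"
  obtains x where "x \<in># u"
    "\<And>\<theta>. comm_theory \<theta> \<Longrightarrow> reaches_bulky \<theta> u \<Longrightarrow> \<exists>s\<ge>1. (u, u + replicate_mset s x) \<in> \<theta>"
  using assms
proof (cases rule: non_bulky_cases)
  case linear
  obtain x where "x \<in># u" using assms(1) by (meson multiset_nonemptyE)
  then show ?thesis using that anchor_letter_linear linear by blast
next
  case (square x)
  then have "u = replicate_mset 2 x" by (simp add: numeral_2_eq_2)
  then show ?thesis
    using that[of x] anchor_letter_power[of _ u 2 x] square by simp
next
  case (cube x)
  then have "u = replicate_mset 3 x" by (simp add: numeral_3_eq_3)
  then show ?thesis
    using that[of x] anchor_letter_power[of _ u 3 x] cube by simp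
next
  case (square_letter x y)
  then have "x \<in># u" by simp
  then show ?thesis using that anchor_letter_square_letter square_letter by blast
qed

text \<open>If \<open>u = ux\<^sup>s\<close> holds in one theory and \<open>u = ux\<^sup>t\<close> in the other, both contain
  \<open>u = ux\<^sup>4\<^sup>s\<^sup>t\<close>.\<close>

lemma common_bulky:
  assumes \<alpha>: "comm_theory \<alpha>" and \<beta>: "comm_theory \<beta>" and u: "u \<noteq> {#}"
    and r: "reaches_bulky \<alpha> u" "reaches_bulky \<beta> u"
  obtains k where "bulky k" "set_mset k = set_mset u" "(u, k) \<in> \<alpha>" "(u, k) \<in> \<beta>"
proof (cases "bulky u")
  case True
  then show ?thesis using that theory_refl[OF \<alpha> u] theory_refl[OF \<beta> u] by blast
next
  case False
  obtain x where x: "x \<in># u"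
    "\<And>\<theta>. comm_theory \<theta> \<Longrightarrow> reaches_bulky \<theta> u \<Longrightarrow> \<exists>s\<ge>1. (u, u + replicate_mset s x) \<in> \<theta>"
    using anchor_letter[OF u False] by blast
  obtain s where s: "1 \<le> s" "(u, u + replicate_mset s x) \<in> \<alpha>" using x(2)[OF \<alpha> r(1)] by blast
  obtain t where t: "1 \<le> t" "(u, u + replicate_mset t x) \<in> \<beta>" using x(2)[OF \<beta> r(2)] by blast
  define k where "k = u + repeat_mset (4 * s * t) {#x#}"
  have "1 * 1 \<le> s * t" using s(1) t(1) by (rule mult_le_mono)
  then have st: "4 \<le> 4 * s * t" by simp
  have rep: "repeat_mset (4 * t) (replicate_mset s x) = repeat_mset (4 * s * t) {#x#}"
    "repeat_mset (4 * s) (replicate_mset t x) = repeat_mset (4 * s * t) {#x#}"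
    by (auto intro: multiset_eqI)
  have "(u, k) \<in> \<alpha>" using theory_iterate[OF \<alpha> s(2), of "4 * t"] unfolding rep k_def .
  moreover have "(u, k) \<in> \<beta>" using theory_iterate[OF \<beta> t(2), of "4 * s"] unfolding rep k_def .
  moreover have "bulky k"
    using bulky_add[OF bulky_repeat[of "{#x#}", OF _ st], of u] by (simp add: k_def ac_simps)
  moreover have "set_mset k = set_mset u" using x(1) by (auto simp: k_def)
  ultimately show ?thesis using that by blast
qed

section \<open>Theories containing \<open>x\<^sup>2y = xy\<^sup>2\<close>\<close>

definition swaps_squares :: "(nat multiset \<times> nat multiset) set \<Rightarrow> bool" where
  "swaps_squares \<theta> \<longleftrightarrow> (\<forall>x y. ({#x, x, y#}, {#x, y, y#}) \<in> \<theta>)"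

lemma swaps_squaresI:
  assumes "comm_theory \<theta>" "({#x, x, y#}, {#x, y, y#}) \<in> \<theta>" "x \<noteq> y"
  shows "swaps_squares \<theta>"
  unfolding swaps_squares_def
proof (intro allI)
  fix a b :: nat
  define f where "f = (\<lambda>c. if c = x then {#a#} else {#b#})"
  have "(substitute f {#x, x, y#}, substitute f {#x, y, y#}) \<in> \<theta>"
    by (rule theory_substitute[OF assms(1,2)]) (simp add: f_def)
  then show "({#a, a, b#}, {#a, b, b#}) \<in> \<theta>"
    using assms(3) by (simp add: f_def add_mset_commute)
qed

lemma swaps_squares_words:
  assumes "comm_theory \<theta>" "swaps_squares \<theta>" "X \<noteq> {#}" "Y \<noteq> {#}"
  shows "(X + X + Y, X + Y + Y) \<in> \<theta>"
proof -
  define f where "f = (\<lambda>c::nat. if c = 0 then X else Y)"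
  have "({#0, 0, 1#}, {#0, 1, 1#}) \<in> \<theta>"
    using assms(2) unfolding swaps_squares_def by blast
  then have "(substitute f {#0, 0, 1#}, substitute f {#0, 1, 1#}) \<in> \<theta>"
    by (rule theory_substitute[OF assms(1)]) (simp add: f_def assms)
  then show ?thesis by (simp add: f_def ac_simps)
qed

text \<open>\<open>X\<^sup>2AB = X(AB)\<^sup>2 = (A\<^sup>2X)B\<^sup>2 = (AX\<^sup>2)B\<^sup>2\<close>: a factor may be doubled next to a square.\<close>

lemma swaps_squares_duplicate:
  assumes \<theta>: "comm_theory \<theta>" and sw: "swaps_squares \<theta>"
    and ne: "X \<noteq> {#}" "A \<noteq> {#}" "B \<noteq> {#}"
  shows "(X + X + A + B, X + X + A + B + B) \<in> \<theta>"
proof -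
  have "A + B \<noteq> {#}" using ne by simp
  then have "(X + X + (A + B), X + (A + B) + (A + B)) \<in> \<theta>"
    by (rule swaps_squares_words[OF \<theta> sw ne(1)])
  moreover have "(A + A + X + (B + B), A + X + X + (B + B)) \<in> \<theta>"
    by (rule theory_add[OF \<theta>], rule swaps_squares_words[OF \<theta> sw ne(2,1)])
  ultimately have "(X + X + (A + B), A + X + X + (B + B)) \<in> \<theta>"
    using theory_trans[OF \<theta>, of "X + X + (A + B)" "X + (A + B) + (A + B)" "A + X + X + (B + B)"]
    by (simp add: ac_simps)
  then show ?thesis by (simp add: ac_simps)
qed

lemma bulky_absorbs_letter:
  assumes \<theta>: "comm_theory \<theta>" and sw: "swaps_squares \<theta>" and u: "bulky u" "y \<in># u"
  shows "(u, u + {#y#}) \<in> \<theta>"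
proof -
  obtain x where "2 \<le> count u x" using u(1) by (auto simp: bulky_def)
  then have "replicate_mset 2 x \<subseteq># u" by (simp add: count_le_replicate_mset_subset_eq)
  then obtain t where "u = replicate_mset 2 x + t" by (auto simp: mset_subset_eq_exists_conv)
  then have t: "u = {#x#} + {#x#} + t" by (simp add: numeral_2_eq_2)
  have "4 \<le> size u" using u(1) by (simp add: bulky_def)
  then have size: "2 \<le> size t" using t by simp
  have main: "(u, u + {#z#}) \<in> \<theta>" if z: "z \<in># t" for z
  proof -
    obtain a where a: "t = add_mset z a" using z by (blast dest: multi_member_split)
    then have "a \<noteq> {#}" using size by auto
    then show ?thesis
      using swaps_squares_duplicate[OF \<theta> sw, of "{#x#}" a "{#z#}"] t a by simp
  qed
  show ?thesis
  proof (cases "y \<in># t")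
    case False
    then have "y = x" using u(2) t by simp
    have "t \<noteq> {#}" using size by auto
    then obtain z where z: "z \<in># t" by (meson multiset_nonemptyE)
    then obtain a where a: "t = add_mset z a" by (blast dest: multi_member_split)
    have "({#z#} + {#z#} + ({#x#} + a) + {#x#}, {#z#} + {#z#} + ({#x#} + a) + {#x#} + {#x#}) \<in> \<theta>"
      by (rule swaps_squares_duplicate[OF \<theta> sw]) simp_all
    then have 1: "(u + {#z#}, u + {#z#} + {#x#}) \<in> \<theta>"
      by (simp add: t a add_mset_commute)
    have 2: "(u + {#z#} + {#x#}, u + {#x#}) \<in> \<theta>"
      using theory_add[OF \<theta> theory_sym[OF \<theta> main[OF z]]] .
    show ?thesis
      unfolding \<open>y = x\<close>
      by (rule theory_trans[OF \<theta> main[OF z]], rule theory_trans[OF \<theta> 1 2])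
  qed (rule main)
qed

text \<open>Both words equal their product, because each absorbs the letters of the other one by one.\<close>

lemma bulky_same_content:
  assumes \<theta>: "comm_theory \<theta>" and sw: "swaps_squares \<theta>"
    and uv: "bulky u" "bulky v" "set_mset u = set_mset v"
  shows "(u, v) \<in> \<theta>"
proof -
  have absorb: "(u, u + t) \<in> \<theta>" if u: "bulky u" and "set_mset t \<subseteq> set_mset u" for u t
    using that(2)
  proof (induction t)
    case empty
    then show ?case using theory_refl[OF \<theta> bulky_nonempty[OF u]] by simp
  next
    case (add x t)
    then have IH: "(u, u + t) \<in> \<theta>" and x: "x \<in># u + t" by auto
    have "(u + t, u + t + {#x#}) \<in> \<theta>"
      by (rule bulky_absorbs_letter[OF \<theta> sw bulky_add[OF u] x])
    then show ?case using theory_trans[OF \<theta> IH] by simp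
  qed
  have "(u, u + v) \<in> \<theta>" using absorb[OF uv(1), of v] uv(3) by simp
  moreover have "(v, u + v) \<in> \<theta>" using absorb[OF uv(2), of u] uv(3) by (simp add: ac_simps)
  ultimately show ?thesis using theory_trans[OF \<theta>] theory_sym[OF \<theta>] by blast
qed

section \<open>Theories that change the content of words\<close>

text \<open>The equational theory of semilattices.\<close>

definition content_theory :: "(nat multiset \<times> nat multiset) set" where
  "content_theory = {(u, v). u \<noteq> {#} \<and> v \<noteq> {#} \<and> set_mset u = set_mset v}"

lemma comm_theory_content: "comm_theory content_theory"
  by (rule comm_theoryI)
    (simp_all add: content_theory_def set_mset_substitute substitute_nonempty)

text \<open>Sending a letter that occurs on one side only to \<open>X\<close> and all others to \<open>Y\<close> gives
  \<open>Y\<^sup>p = Y\<^sup>qX\<^sup>r\<close>; comparing this with its instance for \<open>X\<^sup>2\<close> replaces \<open>q\<close> by \<open>p\<close>, which is what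
  makes the identities of two theories compatible.\<close>

lemma content_changing:
  assumes \<theta>: "comm_theory \<theta>" and "\<not> \<theta> \<subseteq> content_theory"
  obtains p r where "1 \<le> p" "1 \<le> r"
    "\<And>X Y. X \<noteq> {#} \<Longrightarrow> Y \<noteq> {#} \<Longrightarrow> (repeat_mset p Y, repeat_mset p Y + repeat_mset r X) \<in> \<theta>"
proof -
  obtain u' v' where "(u', v') \<in> \<theta>" "set_mset u' \<noteq> set_mset v'"
    using assms(2) theory_nonempty[OF \<theta>] unfolding content_theory_def by blast
  then obtain u v z where uv: "(u, v) \<in> \<theta>" and z: "z \<in># v" "z \<notin># u"
    using theory_sym[OF \<theta>] by (metis subset_antisym subsetI)
  define p r q where "p = size u" and "r = count v z" and "q = size v - r"
  have base: "(repeat_mset p Y, repeat_mset q Y + repeat_mset r X) \<in> \<theta>"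
    if ne: "X \<noteq> {#}" "Y \<noteq> {#}" for X Y
  proof -
    define f where "f = (\<lambda>a. Y)(z := X)"
    have "(substitute f u, substitute f v) \<in> \<theta>"
      by (rule theory_substitute[OF \<theta> uv]) (simp add: f_def ne)
    moreover have "count u z = 0" using z(2) by (simp add: not_in_iff)
    ultimately show ?thesis
      by (simp add: f_def substitute_const_off p_def q_def r_def add.commute)
  qed
  have "(repeat_mset p Y, repeat_mset p Y + repeat_mset r X) \<in> \<theta>"
    if ne: "X \<noteq> {#}" "Y \<noteq> {#}" for X Y
  proof -
    have "(repeat_mset p Y, repeat_mset q Y + repeat_mset r (X + X)) \<in> \<theta>"
      by (rule base) (simp_all add: ne)
    moreover have "(repeat_mset q Y + repeat_mset r X + repeat_mset r X, repeat_mset p Y + repeat_mset r X) \<in> \<theta>"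
      by (rule theory_add[OF \<theta> theory_sym[OF \<theta> base[OF ne]]])
    ultimately show ?thesis using theory_trans[OF \<theta>] by (simp add: ac_simps)
  qed
  moreover have "1 \<le> p" using theory_nonempty[OF \<theta> uv] by (simp add: p_def Suc_le_eq nonempty_has_size)
  moreover have "1 \<le> r" using z(1) by (simp add: r_def Suc_le_eq)
  ultimately show ?thesis using that by blast
qed

lemma content_changing_common:
  assumes \<beta>: "comm_theory \<beta>" "\<not> \<beta> \<subseteq> content_theory"
    and \<gamma>: "comm_theory \<gamma>" "\<not> \<gamma> \<subseteq> content_theory"
  obtains p r where "1 \<le> p" "1 \<le> r"
    "\<And>X Y. X \<noteq> {#} \<Longrightarrow> Y \<noteq> {#} \<Longrightarrow> (repeat_mset p Y, repeat_mset p Y + repeat_mset r X) \<in> \<beta> \<inter> \<gamma>"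
proof -
  obtain p r where p: "1 \<le> p" "1 \<le> r"
    "\<And>X Y. X \<noteq> {#} \<Longrightarrow> Y \<noteq> {#} \<Longrightarrow> (repeat_mset p Y, repeat_mset p Y + repeat_mset r X) \<in> \<beta>"
    using content_changing[OF \<beta>] by blast
  obtain q s where q: "1 \<le> q" "1 \<le> s"
    "\<And>X Y. X \<noteq> {#} \<Longrightarrow> Y \<noteq> {#} \<Longrightarrow> (repeat_mset q Y, repeat_mset q Y + repeat_mset s X) \<in> \<gamma>"
    using content_changing[OF \<gamma>] by blast
  have "(repeat_mset (p + q) Y, repeat_mset (p + q) Y + repeat_mset (r * s) X) \<in> \<beta> \<inter> \<gamma>"
    if ne: "X \<noteq> {#}" "Y \<noteq> {#}" for X Y
  proof -
    have "(repeat_mset p Y, repeat_mset p Y + repeat_mset s (repeat_mset r X)) \<in> \<beta>"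
      by (rule theory_iterate[OF \<beta>(1) p(3)[OF ne]])
    then have "(repeat_mset p Y + repeat_mset q Y, repeat_mset p Y + repeat_mset s (repeat_mset r X) + repeat_mset q Y) \<in> \<beta>"
      by (rule theory_add[OF \<beta>(1)])
    moreover have "(repeat_mset q Y, repeat_mset q Y + repeat_mset r (repeat_mset s X)) \<in> \<gamma>"
      by (rule theory_iterate[OF \<gamma>(1) q(3)[OF ne]])
    then have "(repeat_mset q Y + repeat_mset p Y, repeat_mset q Y + repeat_mset r (repeat_mset s X) + repeat_mset p Y) \<in> \<gamma>"
      by (rule theory_add[OF \<gamma>(1)])
    ultimately show ?thesis by (simp add: repeat_mset_distrib ac_simps)
  qed
  moreover have "1 \<le> p + q" using p(1) by simp
  moreover have "1 * 1 \<le> r * s" using p(2) q(2) by (rule mult_le_mono)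
  ultimately show ?thesis using that[of "p + q" "r * s"] by simp
qed

text \<open>Without the semilattices the bulky words collapse to a zero: \<open>u = u\<^sup>pv\<^sup>r = v\<^sup>pu\<^sup>r = v\<close>, where
  the middle step compares words of equal content.\<close>

lemma bulky_all_equal:
  assumes \<theta>: "comm_theory \<theta>" and sw: "swaps_squares \<theta>" and "\<not> \<theta> \<subseteq> content_theory"
    and uv: "bulky u" "bulky v"
  shows "(u, v) \<in> \<theta>"
proof -
  obtain p r where p: "1 \<le> p" "1 \<le> r"
    "\<And>X Y. X \<noteq> {#} \<Longrightarrow> Y \<noteq> {#} \<Longrightarrow> (repeat_mset p Y, repeat_mset p Y + repeat_mset r X) \<in> \<theta>"
    using content_changing[OF \<theta> assms(3)] by blast
  have grow: "(u, repeat_mset p u + repeat_mset r v) \<in> \<theta> \<and> bulky (repeat_mset p u + repeat_mset r v)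
      \<and> set_mset (repeat_mset p u + repeat_mset r v) = set_mset u \<union> set_mset v"
    if "bulky u" "bulky v" for u v
  proof -
    have c: "set_mset (repeat_mset k w) = set_mset w" if "1 \<le> k" for k and w :: "nat multiset"
      using that by (auto simp flip: count_greater_zero_iff)
    have "u \<subseteq># repeat_mset p u" using p(1) by (simp add: subseteq_mset_def)
    then have b: "bulky (repeat_mset p u)" by (rule bulky_mono[OF that(1)])
    have "(u, repeat_mset p u) \<in> \<theta>"
      by (rule bulky_same_content[OF \<theta> sw that(1) b]) (simp add: c[OF p(1)])
    then show ?thesis
      using theory_trans[OF \<theta> _ p(3)] that[THEN bulky_nonempty] b bulky_add c p(1,2)
      by simp
  qed
  have "(repeat_mset p u + repeat_mset r v, repeat_mset p v + repeat_mset r u) \<in> \<theta>"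
    by (rule bulky_same_content[OF \<theta> sw]) (use grow[OF uv] grow[OF uv(2,1)] in auto)
  then show ?thesis
    using grow[OF uv] grow[OF uv(2,1)] theory_trans[OF \<theta>] theory_sym[OF \<theta>] by blast
qed

section \<open>Standardness\<close>

text \<open>The delicate case of different contents. Pumping inside the content keeps each word within the
  theory \<open>\<alpha>\<close>; once a high power is present, \<open>\<beta> \<inter> \<gamma>\<close> allows it to absorb the missing letters, and
  the two words then have the same content.\<close>

lemma connect_bulky:
  assumes \<alpha>: "comm_theory \<alpha>" and \<beta>: "comm_theory \<beta>" and \<gamma>: "comm_theory \<gamma>"
    and sw: "swaps_squares \<alpha>"
    and nc: "\<not> \<beta> \<subseteq> content_theory" "\<not> \<gamma> \<subseteq> content_theory"
    and kl: "bulky k" "bulky l" "(k, l) \<in> \<gamma>" and z: "z \<in># l" "z \<notin># k"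
  shows "(k, l) \<in> join_theory (\<alpha> \<inter> \<gamma>) (\<beta> \<inter> \<gamma>)"
proof -
  let ?\<delta> = "join_theory (\<alpha> \<inter> \<gamma>) (\<beta> \<inter> \<gamma>)"
  have \<delta>: "comm_theory ?\<delta>"
    using comm_theory_join[OF comm_theory_Int[OF \<alpha> \<gamma>] comm_theory_Int[OF \<beta> \<gamma>]] .
  have \<delta>1: "e \<in> ?\<delta>" if "e \<in> \<alpha>" "e \<in> \<gamma>" for e using that join_theory_upper by blast
  have \<delta>2: "e \<in> ?\<delta>" if "e \<in> \<beta> \<inter> \<gamma>" for e using that join_theory_upper by blast
  obtain p r where p: "1 \<le> p" "1 \<le> r"
    "\<And>X Y. X \<noteq> {#} \<Longrightarrow> Y \<noteq> {#} \<Longrightarrow> (repeat_mset p Y, repeat_mset p Y + repeat_mset r X) \<in> \<beta> \<inter> \<gamma>"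
    using content_changing_common[OF \<beta> nc(1) \<gamma> nc(2)] by blast
  have c: "set_mset (repeat_mset n w) = set_mset w" if "1 \<le> n" for n and w :: "nat multiset"
    using that by (auto simp flip: count_greater_zero_iff)
  have ne: "k \<noteq> {#}" "l \<noteq> {#}" using kl bulky_nonempty by auto
  \<comment> \<open>A word divisible by a \<open>p\<close>-th power absorbs \<open>r\<close>-th powers of arbitrary words.\<close>
  have pump: "(w, w + repeat_mset r X) \<in> \<beta> \<inter> \<gamma>"
    if Yw: "repeat_mset p Y \<subseteq># w" and ne: "X \<noteq> {#}" "Y \<noteq> {#}" for w X Y
  proof -
    obtain t where t: "w = repeat_mset p Y + t" using Yw by (auto simp: mset_subset_eq_exists_conv)
    have "(repeat_mset p Y + t, repeat_mset p Y + repeat_mset r X + t) \<in> \<beta> \<inter> \<gamma>"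
      by (rule theory_add[OF comm_theory_Int[OF \<beta> \<gamma>] p(3)[OF ne]])
    then show ?thesis by (simp add: t ac_simps)
  qed
  \<comment> \<open>\<open>f\<close> fixes \<open>k\<close> and turns \<open>l\<close> into a word with the content of \<open>k\<close>; \<open>g\<close> fixes \<open>k\<close> and the content of \<open>l\<close>.\<close>
  define f where "f = (\<lambda>a. if a \<in># k then {#a#} else repeat_mset p k)"
  define g where "g = (\<lambda>a. {#a#})(z := repeat_mset p {#z#})"
  define k' where "k' = substitute f l"
  define l' where "l' = substitute g l"
  have f: "f a \<noteq> {#}" for a using ne p(1) by (simp add: f_def repeat_mset_eq_empty_iff)
  have g: "g a \<noteq> {#}" for a using p(1) by (simp add: g_def)
  have "(substitute f k, substitute f l) \<in> \<gamma>" by (rule theory_substitute[OF \<gamma> kl(3)]) (rule f)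
  moreover have "substitute f k = k" by (rule substitute_fixed) (simp add: f_def)
  ultimately have k'\<gamma>: "(k, k') \<in> \<gamma>" by (simp add: k'_def)
  have "(substitute g k, substitute g l) \<in> \<gamma>" by (rule theory_substitute[OF \<gamma> kl(3)]) (rule g)
  moreover have "substitute g k = k" unfolding g_def by (rule substitute_fresh[OF z(2)])
  ultimately have l'\<gamma>: "(k, l') \<in> \<gamma>" by (simp add: l'_def)
  have b: "bulky k'" "bulky l'"
    unfolding k'_def l'_def using bulky_substitute[OF kl(2)] f g by blast+
  have sub: "repeat_mset p k \<subseteq># k'" "repeat_mset p {#z#} \<subseteq># l'"
    using substitute_contains[OF z(1), of f] substitute_contains[OF z(1), of g] z(2)
    by (simp_all add: k'_def l'_def f_def g_def)
  have "set_mset k' \<subseteq> set_mset k"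
    by (auto simp: k'_def set_mset_substitute f_def c[OF p(1)] split: if_splits)
  moreover have "set_mset k \<subseteq> set_mset k'" using set_mset_mono[OF sub(1)] c[OF p(1)] by simp
  ultimately have ck: "set_mset k' = set_mset k" by blast
  have ga: "set_mset (g a) = {a}" for a using p(1) by (simp add: g_def c)
  have cl: "set_mset l' = set_mset l" by (simp add: l'_def set_mset_substitute ga)
  have 1: "(k, k') \<in> ?\<delta>"
    by (rule \<delta>1[OF bulky_same_content[OF \<alpha> sw kl(1) b(1)] k'\<gamma>]) (simp add: ck)
  have 2: "(k', k' + repeat_mset r l) \<in> ?\<delta>"
    by (rule \<delta>2[OF pump[OF sub(1) ne(2,1)]])
  have l\<gamma>: "(l, l') \<in> \<gamma>" by (rule theory_trans[OF \<gamma> theory_sym[OF \<gamma> kl(3)] l'\<gamma>])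
  have 3: "(l, l') \<in> ?\<delta>"
    by (rule \<delta>1[OF bulky_same_content[OF \<alpha> sw kl(2) b(2)] l\<gamma>]) (simp add: cl)
  have 4: "(l', l' + repeat_mset r k) \<in> ?\<delta>"
    by (rule \<delta>2[OF pump[OF sub(2) ne(1)]]) simp
  have "(k' + repeat_mset r l, k') \<in> \<gamma>"
    using theory_sym[OF \<gamma>] pump[OF sub(1) ne(2,1)] by blast
  moreover have "(k', l') \<in> \<gamma>" by (rule theory_trans[OF \<gamma> theory_sym[OF \<gamma> k'\<gamma>] l'\<gamma>])
  moreover have "(l', l' + repeat_mset r k) \<in> \<gamma>" using pump[OF sub(2) ne(1)] by simp
  ultimately have "(k' + repeat_mset r l, l' + repeat_mset r k) \<in> \<gamma>"
    using theory_trans[OF \<gamma>] by blast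
  moreover have "(k' + repeat_mset r l, l' + repeat_mset r k) \<in> \<alpha>"
    by (rule bulky_same_content[OF \<alpha> sw bulky_add[OF b(1)] bulky_add[OF b(2)]])
      (simp add: ck cl c[OF p(2)] Un_commute)
  ultimately have 5: "(k' + repeat_mset r l, l' + repeat_mset r k) \<in> ?\<delta>" by (simp add: \<delta>1)
  show ?thesis
    using theory_trans[OF \<delta> theory_trans[OF \<delta> theory_trans[OF \<delta> 1 2] 5]
        theory_sym[OF \<delta> theory_trans[OF \<delta> 3 4]]] .
qed

text \<open>The first nontrivial step of a path in the join leaves \<open>u\<close> along one of the two theories. By the
  dichotomy either the class of \<open>u\<close> in that theory contains a bulky word, or the path stays in
  \<open>{x\<^sup>2y, xy\<^sup>2}\<close>.\<close>

lemma join_leaves_class: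
  assumes \<alpha>: "comm_theory \<alpha>" and \<beta>: "comm_theory \<beta>" and sw: "swaps_squares \<alpha>"
    and uv: "(u, v) \<in> join_theory \<alpha> \<beta>" "u \<noteq> v"
  shows "reaches_bulky \<alpha> u \<or> reaches_bulky \<beta> u \<or> (u, v) \<in> \<alpha>"
proof (rule ccontr)
  assume contra: "\<not> ?thesis"
  have stuck: "s = t \<or> (\<exists>x y. x \<noteq> y \<and> s = {#x, x, y#} \<and> t = {#x, y, y#})"
    if "(s, t) \<in> \<alpha> \<union> \<beta>" "\<not> reaches_bulky \<alpha> s" "\<not> reaches_bulky \<beta> s" for s t
    using that theory_pair_cases[OF \<alpha>, of s t] theory_pair_cases[OF \<beta>, of s t] by blast
  have path: "(u, v) \<in> (\<alpha> \<union> \<beta>)\<^sup>+" using uv(1) by (simp add: join_theory_def)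
  show False
  proof (cases "\<exists>x y. x \<noteq> y \<and> u = {#x, x, y#}")
    case False
    have "v \<in> {u}"
      by (rule trancl_stays[OF path]) (use stuck[of u] contra False in blast)+
    then show False using uv(2) by simp
  next
    case True
    then obtain x y where xy: "x \<noteq> y" "u = {#x, x, y#}" by blast
    define f where "f = (\<lambda>c. {#c#})(x := {#y#}, y := {#x#})"
    define u' where "u' = {#x, y, y#}"
    have f: "f c \<noteq> {#}" for c by (simp add: f_def)
    have fu: "substitute f u' = u" using xy by (simp add: u'_def f_def add_mset_commute)
    have "\<not> reaches_bulky \<theta> u'" if "comm_theory \<theta>" "\<not> reaches_bulky \<theta> u" for \<theta>
      using reaches_bulky_substitute[OF that(1), of u' f] f fu that(2) by metis
    then have u': "\<not> reaches_bulky \<alpha> u'" "\<not> reaches_bulky \<beta> u'" using contra \<alpha> \<beta> by blast+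
    have swap: "t \<in> {u, u'}" if "s \<in> {u, u'}" "a \<noteq> b" "s = {#a, a, b#}" "t = {#a, b, b#}" for s t a b
    proof -
      have "(a = x \<and> b = y) \<or> (a = y \<and> b = x)"
        using that xy by (auto simp: u'_def add_eq_conv_ex)
      then show ?thesis using that(4) xy by (auto simp: u'_def add_mset_commute)
    qed
    have "v \<in> {u, u'}"
    proof (rule trancl_stays[OF path])
      fix s t assume st: "(s, t) \<in> \<alpha> \<union> \<beta>" "s \<in> {u, u'}"
      then have "\<not> reaches_bulky \<alpha> s" "\<not> reaches_bulky \<beta> s" using u' contra by blast+
      then show "t \<in> {u, u'}" using stuck[OF st(1)] st(2) swap[OF st(2)] by blast
    qed simp
    then have "v = {#x, y, y#}" using uv(2) by (simp add: u'_def)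
    then show False using contra sw xy(2) unfolding swaps_squares_def by blast
  qed
qed

text \<open>The order dual of being costandard, since theories and varieties are in reverse order;
  likewise \<open>modular\<close> below is self-dual and \<open>lower_modular\<close> is dual to upper-modular.\<close>

definition standard_theory :: "(nat multiset \<times> nat multiset) set \<Rightarrow> bool" where
  "standard_theory \<alpha> \<longleftrightarrow> (\<forall>\<beta> \<gamma>. comm_theory \<beta> \<longrightarrow> comm_theory \<gamma> \<longrightarrow>
     join_theory \<alpha> \<beta> \<inter> \<gamma> = join_theory (\<alpha> \<inter> \<gamma>) (\<beta> \<inter> \<gamma>))"

text \<open>Suppose \<open>(u, v)\<close> lies in \<open>(\<alpha> \<or> \<beta>) \<inter> \<gamma>\<close> but not in \<open>\<alpha>\<close>. The class of \<open>u\<close> in \<open>\<gamma>\<close> and in one of \<open>\<alpha>\<close>, \<open>\<beta>\<close>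
  contains bulky words, hence a common one of the same content as \<open>u\<close>; the same holds for \<open>v\<close>. So \<open>u\<close>
  and \<open>v\<close> may be assumed bulky, and \<open>\<alpha>\<close> identifies bulky words of equal content.\<close>

lemma swaps_squares_standard:
  assumes \<alpha>: "comm_theory \<alpha>" and sw: "swaps_squares \<alpha>"
  shows "standard_theory \<alpha>"
  unfolding standard_theory_def
proof (intro allI impI subset_antisym)
  fix \<beta> \<gamma> assume \<beta>: "comm_theory \<beta>" and \<gamma>: "comm_theory \<gamma>"
  let ?\<delta> = "join_theory (\<alpha> \<inter> \<gamma>) (\<beta> \<inter> \<gamma>)"
  have \<alpha>\<beta>: "comm_theory (join_theory \<alpha> \<beta>)" by (rule comm_theory_join[OF \<alpha> \<beta>])
  show "?\<delta> \<subseteq> join_theory \<alpha> \<beta> \<inter> \<gamma>"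
    by (rule join_theory_least[OF comm_theory_Int[OF \<alpha>\<beta> \<gamma>]])
      (use join_theory_upper[of \<alpha> \<beta>] join_theory_upper[of \<beta> \<alpha>] in blast)+
  have \<delta>: "comm_theory ?\<delta>"
    using comm_theory_join[OF comm_theory_Int[OF \<alpha> \<gamma>] comm_theory_Int[OF \<beta> \<gamma>]] .
  have \<delta>1: "e \<in> ?\<delta>" if "e \<in> \<alpha>" "e \<in> \<gamma>" for e using that join_theory_upper by blast
  have \<delta>2: "e \<in> ?\<delta>" if "e \<in> \<beta>" "e \<in> \<gamma>" for e using that join_theory_upper by blast
  have toBulky: "(u, v) \<in> \<alpha> \<or> (\<exists>k. bulky k \<and> set_mset k = set_mset u \<and> (u, k) \<in> ?\<delta> \<and> (u, k) \<in> \<gamma>)"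
    if uv: "(u, v) \<in> join_theory \<alpha> \<beta>" "(u, v) \<in> \<gamma>" "u \<noteq> v" for u v
  proof (cases "(u, v) \<in> \<alpha>")
    case False
    have ne: "u \<noteq> {#}" using theory_nonempty[OF \<gamma> uv(2)] by simp
    have "\<not> (\<exists>x y. x \<noteq> y \<and> u = {#x, x, y#} \<and> v = {#x, y, y#})"
      using False sw unfolding swaps_squares_def by blast
    then have g: "reaches_bulky \<gamma> u" using theory_pair_cases[OF \<gamma> uv(2,3)] by blast
    consider "reaches_bulky \<alpha> u" | "reaches_bulky \<beta> u"
      using join_leaves_class[OF \<alpha> \<beta> sw uv(1,3)] False by blast
    then show ?thesis
    proof cases
      case 1
      show ?thesis using common_bulky[OF \<alpha> \<gamma> ne 1 g] \<delta>1 by metis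
    next
      case 2
      show ?thesis using common_bulky[OF \<beta> \<gamma> ne 2 g] \<delta>2 by metis
    qed
  qed blast
  show "join_theory \<alpha> \<beta> \<inter> \<gamma> \<subseteq> ?\<delta>"
  proof clarify
    fix u v assume uv: "(u, v) \<in> join_theory \<alpha> \<beta>" "(u, v) \<in> \<gamma>"
    show "(u, v) \<in> ?\<delta>"
    proof (cases "u = v \<or> (u, v) \<in> \<alpha>")
      case True
      then show ?thesis using \<delta>1 uv(2) theory_refl[OF \<delta>] theory_nonempty[OF \<gamma> uv(2)] by blast
    next
      case False
      then have "u \<noteq> v" "v \<noteq> u" "(u, v) \<notin> \<alpha>" "(v, u) \<notin> \<alpha>" using theory_sym[OF \<alpha>] by blast+
      obtain k where k: "bulky k" "set_mset k = set_mset u" "(u, k) \<in> ?\<delta>" "(u, k) \<in> \<gamma>"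
        using toBulky[OF uv \<open>u \<noteq> v\<close>] \<open>(u, v) \<notin> \<alpha>\<close> by blast
      obtain l where l: "bulky l" "set_mset l = set_mset v" "(v, l) \<in> ?\<delta>" "(v, l) \<in> \<gamma>"
        using toBulky[OF theory_sym[OF \<alpha>\<beta> uv(1)] theory_sym[OF \<gamma> uv(2)] \<open>v \<noteq> u\<close>]
          \<open>(v, u) \<notin> \<alpha>\<close> by blast
      have kl: "(k, l) \<in> \<gamma>"
        by (rule theory_trans[OF \<gamma> theory_trans[OF \<gamma> theory_sym[OF \<gamma> k(4)] uv(2)] l(4)])
      have "(k, l) \<in> ?\<delta>"
      proof (cases "set_mset k = set_mset l \<or> \<not> \<alpha> \<subseteq> content_theory")
        case True
        then have "(k, l) \<in> \<alpha>"
          using bulky_same_content[OF \<alpha> sw k(1) l(1)] bulky_all_equal[OF \<alpha> sw _ k(1) l(1)] by blast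
        then show ?thesis using \<delta>1 kl by blast
      next
        case False
        then have "(u, v) \<notin> content_theory" using k(2) l(2) by (simp add: content_theory_def)
        then have "\<not> \<gamma> \<subseteq> content_theory" using uv(2) by blast
        moreover have "\<not> \<beta> \<subseteq> content_theory"
          using join_theory_least[OF comm_theory_content, of \<alpha> \<beta>] False uv(1)
            \<open>(u, v) \<notin> content_theory\<close> by blast
        moreover obtain z where "z \<in># l \<and> z \<notin># k \<or> z \<in># k \<and> z \<notin># l" using False by blast
        ultimately have "(k, l) \<in> ?\<delta> \<or> (l, k) \<in> ?\<delta>"
          using connect_bulky[OF \<alpha> \<beta> \<gamma> sw _ _ k(1) l(1) kl]
            connect_bulky[OF \<alpha> \<beta> \<gamma> sw _ _ l(1) k(1) theory_sym[OF \<gamma> kl]] by blast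
        then show ?thesis using theory_sym[OF \<delta>] by blast
      qed
      then show ?thesis
        by (rule theory_trans[OF \<delta> theory_trans[OF \<delta> k(3)] theory_sym[OF \<delta> l(3)]])
    qed
  qed
qed

section \<open>Modularity forces \<open>x\<^sup>2y = xy\<^sup>2\<close>\<close>

definition modular_theory :: "(nat multiset \<times> nat multiset) set \<Rightarrow> bool" where
  "modular_theory \<alpha> \<longleftrightarrow> (\<forall>\<beta> \<gamma>. comm_theory \<beta> \<longrightarrow> comm_theory \<gamma> \<longrightarrow> \<gamma> \<subseteq> \<beta> \<longrightarrow>
     join_theory (\<alpha> \<inter> \<beta>) \<gamma> = join_theory \<alpha> \<gamma> \<inter> \<beta>)"

definition lower_modular_theory :: "(nat multiset \<times> nat multiset) set \<Rightarrow> bool" where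
  "lower_modular_theory \<alpha> \<longleftrightarrow> (\<forall>\<beta> \<gamma>. comm_theory \<beta> \<longrightarrow> comm_theory \<gamma> \<longrightarrow> \<alpha> \<subseteq> \<beta> \<longrightarrow>
     join_theory \<alpha> (\<beta> \<inter> \<gamma>) = \<beta> \<inter> join_theory \<alpha> \<gamma>)"

lemma standard_modular: "standard_theory \<alpha> \<Longrightarrow> modular_theory \<alpha>"
  unfolding standard_theory_def modular_theory_def by (metis inf.absorb_iff1)

lemma standard_lower_modular: "standard_theory \<alpha> \<Longrightarrow> lower_modular_theory \<alpha>"
  unfolding standard_theory_def lower_modular_theory_def by (metis inf.absorb_iff1 inf_commute)

definition equality_theory :: "(nat multiset \<times> nat multiset) set" where
  "equality_theory = {(u, u) |u. u \<noteq> {#}}"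

lemma comm_theory_equality: "comm_theory equality_theory"
  by (rule comm_theoryI) (auto simp: equality_theory_def dest: substitute_nonempty)

lemma equality_theory_least: "comm_theory \<theta> \<Longrightarrow> equality_theory \<subseteq> \<theta>"
  using theory_refl by (auto simp: equality_theory_def)

lemma equality_theory_standard: "standard_theory equality_theory"
  unfolding standard_theory_def
proof (intro allI impI)
  fix \<beta> \<gamma> assume \<beta>: "comm_theory \<beta>" and \<gamma>: "comm_theory \<gamma>"
  have join: "join_theory equality_theory \<theta> = \<theta>" if "comm_theory \<theta>" for \<theta>
    using join_theory_least[OF that equality_theory_least[OF that]] join_theory_upper(2) by blast
  show "join_theory equality_theory \<beta> \<inter> \<gamma> = join_theory (equality_theory \<inter> \<gamma>) (\<beta> \<inter> \<gamma>)"
    using join[OF \<beta>] join[OF comm_theory_Int[OF \<beta> \<gamma>]] equality_theory_least[OF \<gamma>]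
    by (simp add: inf.absorb1)
qed

text \<open>The next three theories are the test elements for the modular laws: words of length at
  least four are collapsed, then \<open>x\<^sup>2y = xy\<^sup>2\<close> is added, and finally exponents are compared
  modulo \<open>d\<close> as in abelian groups of exponent \<open>d\<close>.\<close>

definition length4_theory :: "(nat multiset \<times> nat multiset) set" where
  "length4_theory = {(u, v). u \<noteq> {#} \<and> v \<noteq> {#} \<and> (u = v \<or> 4 \<le> size u \<and> 4 \<le> size v)}"

lemma comm_theory_length4: "comm_theory length4_theory"
proof (rule comm_theoryI)
  fix u v and f :: "nat \<Rightarrow> nat multiset"
  assume "(u, v) \<in> length4_theory" "\<forall>x. f x \<noteq> {#}"
  then show "(substitute f u, substitute f v) \<in> length4_theory"
    using size_substitute_ge[of f u] size_substitute_ge[of f v] substitute_nonempty[of u f]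
      substitute_nonempty[of v f] by (auto simp: length4_theory_def)
qed (auto simp: length4_theory_def)

definition length4_swap_theory :: "(nat multiset \<times> nat multiset) set" where
  "length4_swap_theory =
     length4_theory \<union> {({#x, x, y#}, {#x, y, y#}) |x y. x \<noteq> y}"

lemma swap_pair_eq:
  assumes "{#x, x, y#} = {#a, a, b#}" "x \<noteq> (y::nat)"
  shows "x = a \<and> y = b"
  using assms by (auto simp: add_eq_conv_ex)

lemma comm_theory_length4_swap: "comm_theory length4_swap_theory"
proof (rule comm_theoryI)
  fix u v assume uv: "(u, v) \<in> length4_swap_theory"
  then consider "(u, v) \<in> length4_theory" | x y where "x \<noteq> y" "u = {#x, x, y#}" "v = {#x, y, y#}"
    by (auto simp: length4_swap_theory_def)
  note cases = this
  show "u \<noteq> {#} \<and> v \<noteq> {#}"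
    using cases by cases (auto simp: length4_theory_def)
  show "(v, u) \<in> length4_swap_theory"
    using cases
  proof cases
    case 1
    then show ?thesis using theory_sym[OF comm_theory_length4] by (simp add: length4_swap_theory_def)
  next
    case (2 x y)
    then have "v = {#y, y, x#}" "u = {#y, x, x#}" "y \<noteq> x" by (auto simp: add_mset_commute)
    then show ?thesis unfolding length4_swap_theory_def by blast
  qed
  show "(u + t, v + t) \<in> length4_swap_theory" for t
    using cases
  proof cases
    case 1
    then show ?thesis using theory_add[OF comm_theory_length4] by (simp add: length4_swap_theory_def)
  next
    case (2 x y)
    show ?thesis
    proof (cases "t = {#}")
      case False
      then have "1 \<le> size t" by (simp add: Suc_le_eq nonempty_has_size)
      then show ?thesis using 2 by (simp add: length4_swap_theory_def length4_theory_def)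
    qed (use uv in simp)
  qed
  show "(substitute f u, substitute f v) \<in> length4_swap_theory" if f: "\<forall>x. f x \<noteq> {#}" for f
    using cases
  proof cases
    case 1
    have "(substitute f u, substitute f v) \<in> length4_theory"
      by (rule theory_substitute[OF comm_theory_length4 1]) (use f in blast)
    then show ?thesis by (simp add: length4_swap_theory_def)
  next
    case (2 x y)
    have fs: "substitute f u = f x + f x + f y" "substitute f v = f x + f y + f y"
      using 2 by (simp_all add: ac_simps)
    have pos: "1 \<le> size (f x)" "1 \<le> size (f y)"
      using f by (simp_all add: Suc_le_eq nonempty_has_size)
    show ?thesis
    proof (cases "size (f x) = 1 \<and> size (f y) = 1")
      case True
      then obtain a b where "f x = {#a#}" "f y = {#b#}" using size_1_singleton_mset by metis
      then have "substitute f u = {#a, a, b#}" "substitute f v = {#a, b, b#}"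
        using fs by (simp_all add: add_mset_commute)
      then show ?thesis
        by (cases "a = b") (auto simp: length4_swap_theory_def length4_theory_def)
    next
      case False
      then have "4 \<le> size (substitute f u)" "4 \<le> size (substitute f v)"
        using pos unfolding fs size_union by linarith+
      moreover have "substitute f u \<noteq> {#}" "substitute f v \<noteq> {#}" using fs f by auto
      ultimately show ?thesis by (simp add: length4_swap_theory_def length4_theory_def)
    qed
  qed
next
  fix u v w assume uv: "(u, v) \<in> length4_swap_theory" and vw: "(v, w) \<in> length4_swap_theory"
  have tri: "(s, t) \<in> length4_theory \<Longrightarrow> s = t \<or> 4 \<le> size s \<and> 4 \<le> size t" for s t
    by (auto simp: length4_theory_def)
  show "(u, w) \<in> length4_swap_theory"
  proof (cases "u = v \<or> v = w")
    case True
    then show ?thesis using uv vw by blast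
  next
    case False
    show ?thesis
    proof (cases "(u, v) \<in> length4_theory \<or> (v, w) \<in> length4_theory")
      case True
      have "(s, t) \<in> length4_theory" if "(s, t) \<in> length4_swap_theory" "4 \<le> size s \<or> 4 \<le> size t" for s t
        using that by (auto simp: length4_swap_theory_def)
      then have "(u, v) \<in> length4_theory" "(v, w) \<in> length4_theory"
        using True False tri[of u v] tri[of v w] uv vw by blast+
      then show ?thesis
        using theory_trans[OF comm_theory_length4] by (simp add: length4_swap_theory_def)
    next
      case False
      then obtain x y a b where xy: "x \<noteq> y" "u = {#x, x, y#}" "v = {#x, y, y#}"
        and ab: "a \<noteq> b" "v = {#a, a, b#}" "w = {#a, b, b#}"
        using uv vw unfolding length4_swap_theory_def by blast
      have "{#y, y, x#} = {#a, a, b#}" using xy ab by (simp add: add_mset_commute)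
      then have "y = a \<and> x = b" by (rule swap_pair_eq) (use xy in simp)
      then have "w = u" using xy ab by (simp add: add_mset_commute)
      moreover have "u \<noteq> {#}" using xy by simp
      ultimately show ?thesis by (simp add: length4_swap_theory_def length4_theory_def)
    qed
  qed
qed (auto simp: length4_swap_theory_def length4_theory_def)

definition exponents_mod_theory :: "nat \<Rightarrow> (nat multiset \<times> nat multiset) set" where
  "exponents_mod_theory d = {(u, v). u \<noteq> {#} \<and> v \<noteq> {#} \<and>
     (\<exists>a b. u + repeat_mset d a = v + repeat_mset d b)}"

lemma comm_theory_exponents_mod: "comm_theory (exponents_mod_theory d)"
proof (rule comm_theoryI)
  fix u v w
  assume "(u, v) \<in> exponents_mod_theory d" "(v, w) \<in> exponents_mod_theory d"
  then obtain a b c e where ne: "u \<noteq> {#}" "w \<noteq> {#}"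
    and eq: "u + repeat_mset d a = v + repeat_mset d b" "v + repeat_mset d c = w + repeat_mset d e"
    by (auto simp: exponents_mod_theory_def)
  have "u + repeat_mset d (a + c) = w + repeat_mset d (e + b)"
    using eq by (metis add.assoc add.commute repeat_mset_distrib2)
  then show "(u, w) \<in> exponents_mod_theory d" using ne unfolding exponents_mod_theory_def by blast
next
  fix u v t
  assume "(u, v) \<in> exponents_mod_theory d"
  then obtain a b where ne: "u \<noteq> {#}" "v \<noteq> {#}"
    and eq: "u + repeat_mset d a = v + repeat_mset d b"
    by (auto simp: exponents_mod_theory_def)
  have "u + t + repeat_mset d a = v + t + repeat_mset d b"
    using eq by (metis add.assoc add.commute)
  then show "(u + t, v + t) \<in> exponents_mod_theory d"
    using ne unfolding exponents_mod_theory_def by blast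
next
  fix u v and f :: "nat \<Rightarrow> nat multiset"
  assume "(u, v) \<in> exponents_mod_theory d" and f: "\<forall>x. f x \<noteq> {#}"
  then obtain a b where ne: "u \<noteq> {#}" "v \<noteq> {#}"
    and eq: "u + repeat_mset d a = v + repeat_mset d b"
    by (auto simp: exponents_mod_theory_def)
  have "substitute f u + repeat_mset d (substitute f a) = substitute f v + repeat_mset d (substitute f b)"
    using arg_cong[OF eq, of "substitute f"] by simp
  then show "(substitute f u, substitute f v) \<in> exponents_mod_theory d"
    using ne f substitute_nonempty[of u f] substitute_nonempty[of v f]
    unfolding exponents_mod_theory_def by blast
next
  fix u v
  assume "(u, v) \<in> exponents_mod_theory d"
  then obtain a b where "u \<noteq> {#}" "v \<noteq> {#}" "u + repeat_mset d a = v + repeat_mset d b"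
    unfolding exponents_mod_theory_def by blast
  moreover from this(3) have "v + repeat_mset d b = u + repeat_mset d a" by (rule sym)
  ultimately show "(v, u) \<in> exponents_mod_theory d"
    unfolding exponents_mod_theory_def by blast
qed (auto simp: exponents_mod_theory_def)

text \<open>Let \<open>z\<close> occur differently often in the two sides of an identity. Substitute \<open>X\<close> for all letters, or
  \<open>X\<^sup>2\<close> for \<open>z\<close> and \<open>X\<close> for the others: at least one of the results equates different powers of \<open>X\<close>.\<close>

lemma periodic:
  assumes \<alpha>: "comm_theory \<alpha>" and "\<alpha> \<noteq> equality_theory"
  obtains p r where "1 \<le> p" "1 \<le> r"
    "\<And>X. X \<noteq> {#} \<Longrightarrow> (repeat_mset p X, repeat_mset p X + repeat_mset r X) \<in> \<alpha>"
proof -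
  have "\<not> \<alpha> \<subseteq> equality_theory" using assms equality_theory_least by blast
  then obtain u v where uv: "(u, v) \<in> \<alpha>" "(u, v) \<notin> equality_theory" by auto
  then have "u \<noteq> v" using theory_nonempty[OF \<alpha> uv(1)] by (auto simp: equality_theory_def)
  then obtain z where z: "count u z \<noteq> count v z" using multiset_eqI[of u v] by blast
  define len where "len k w = k * count w z + (size w - count w z)" for k and w :: "nat multiset"
  have lens: "(repeat_mset (len k u) X, repeat_mset (len k v) X) \<in> \<alpha>" if k: "1 \<le> k" and X: "X \<noteq> {#}" for k X
  proof -
    have kX: "repeat_mset k X \<noteq> {#}" using k X by (simp add: repeat_mset_eq_empty_iff)
    have "(substitute ((\<lambda>a. X)(z := repeat_mset k X)) u, substitute ((\<lambda>a. X)(z := repeat_mset k X)) v) \<in> \<alpha>"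
      by (rule theory_substitute[OF \<alpha> uv(1)]) (simp add: X kX)
    then show ?thesis
      by (simp add: substitute_const_off len_def repeat_mset_distrib mult.commute)
  qed
  have le: "count u z \<le> size u" "count v z \<le> size v" by (simp_all add: count_le_size)
  have pos: "1 \<le> size u" "1 \<le> size v"
    using theory_nonempty[OF \<alpha> uv(1)] by (simp_all add: Suc_le_eq nonempty_has_size)
  have "len 1 u \<noteq> len 1 v \<or> len 2 u \<noteq> len 2 v" using z le by (auto simp: len_def)
  then obtain k where k: "1 \<le> k" "len k u \<noteq> len k v" by (metis one_le_numeral le_refl)
  have len1: "1 \<le> len k w" if "1 \<le> size w" "count w z \<le> size w" for w
  proof -
    have "1 * count w z \<le> k * count w z" using k(1) by (rule mult_le_mono1)
    then show ?thesis using that unfolding len_def by linarith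
  qed
  define p r where "p = min (len k u) (len k v)" and "r = max (len k u) (len k v) - p"
  have pr: "1 \<le> p" "1 \<le> r" using len1 pos le k(2) by (auto simp: p_def r_def)
  have "(repeat_mset p X, repeat_mset p X + repeat_mset r X) \<in> \<alpha>" if "X \<noteq> {#}" for X
  proof -
    have "(repeat_mset p X, repeat_mset (p + r) X) \<in> \<alpha>"
      using lens[OF k(1) that] theory_sym[OF \<alpha> lens[OF k(1) that]]
      by (cases "len k u \<le> len k v") (simp_all add: p_def r_def min_def max_def)
    then show ?thesis by (simp add: repeat_mset_distrib)
  qed
  then show ?thesis using that pr by blast
qed

text \<open>Were \<open>x\<^sup>2y\<close> alone in its class, its class in \<open>\<beta> = \<alpha> \<or> length4_swap_theory\<close> would be
  \<open>{x\<^sup>2y, xy\<^sup>2}\<close>. Modulo \<open>d = r + 1\<close>, a number coprime to the period \<open>r\<close> of \<open>\<alpha>\<close>, the words \<open>x\<^sup>2y\<close> and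
  \<open>xy\<^sup>2\<close> differ; but \<open>x\<^sup>2y\<close> agrees modulo \<open>d\<close> with some \<open>x\<^sup>ay\<^sup>b\<close> with large exponents congruent modulo \<open>r\<close>,
  and \<open>\<alpha>\<close> identifies this word with \<open>x\<^sup>by\<^sup>a\<close>. So \<open>x\<^sup>2y = xy\<^sup>2\<close> lies in \<open>\<beta>\<close> and in the join of \<open>\<alpha>\<close> with
  the theory \<open>\<gamma>\<close> of exponents modulo \<open>d\<close>, but not in the join of \<open>\<alpha>\<close> and \<open>\<beta> \<inter> \<gamma>\<close>.\<close>

lemma lower_modular_moves:
  assumes \<alpha>: "comm_theory \<alpha>" and lm: "lower_modular_theory \<alpha>" and ne: "\<alpha> \<noteq> equality_theory"
  shows "\<exists>w. w \<noteq> {#0, 0, 1#} \<and> ({#0, 0, 1#}, w) \<in> \<alpha>"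
proof (rule ccontr)
  assume contra: "\<not> ?thesis"
  define u v where "u = {#0, 0, 1 :: nat#}" and "v = {#0, 1, 1 :: nat#}"
  define f where "f = (\<lambda>c::nat. {#c#})(0 := {#1#}, 1 := {#0#})"
  have fuv: "substitute f u = v" "substitute f v = u" by (simp_all add: f_def u_def v_def add_mset_commute)
  have ff: "substitute f (substitute f w) = w" for w
    by (induction w) (auto simp: f_def)
  have u\<alpha>: "w = u" if "(u, w) \<in> \<alpha>" for w
    using that contra unfolding u_def by blast
  have v\<alpha>: "w = v" if vw: "(v, w) \<in> \<alpha>" for w
  proof -
    have "(substitute f v, substitute f w) \<in> \<alpha>"
      by (rule theory_substitute[OF \<alpha> vw]) (simp add: f_def)
    then have "substitute f w = u" using u\<alpha> fuv by simp
    then show ?thesis using ff[of w] fuv by simp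
  qed
  obtain p r where p: "1 \<le> p" "1 \<le> r"
    "\<And>X. X \<noteq> {#} \<Longrightarrow> (repeat_mset p X, repeat_mset p X + repeat_mset r X) \<in> \<alpha>"
    using periodic[OF \<alpha> ne] by blast
  define d where "d = r + 1"
  let ?\<beta> = "join_theory \<alpha> length4_swap_theory" and ?\<gamma> = "exponents_mod_theory d"
  have \<beta>: "comm_theory ?\<beta>" by (rule comm_theory_join[OF \<alpha> comm_theory_length4_swap])
  have \<gamma>: "comm_theory ?\<gamma>" by (rule comm_theory_exponents_mod)
  have eq: "join_theory \<alpha> (?\<beta> \<inter> ?\<gamma>) = ?\<beta> \<inter> join_theory \<alpha> ?\<gamma>"
    using lm \<beta> \<gamma> join_theory_upper(1) unfolding lower_modular_theory_def by blast
  have swap: "(u, v) \<in> length4_swap_theory"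
    unfolding length4_swap_theory_def u_def v_def by (intro UnI2 CollectI exI[of _ 0] exI[of _ 1]) simp
  have \<beta>u: "w \<in> {u, v}" if "(u, w) \<in> ?\<beta>" for w
  proof (rule trancl_stays[of u w "\<alpha> \<union> length4_swap_theory" "{u, v}"])
    show "(u, w) \<in> (\<alpha> \<union> length4_swap_theory)\<^sup>+" using that by (simp add: join_theory_def)
    fix s t assume st: "(s, t) \<in> \<alpha> \<union> length4_swap_theory" "s \<in> {u, v}"
    show "t \<in> {u, v}"
    proof (cases "(s, t) \<in> \<alpha>")
      case True
      then show ?thesis using st(2) u\<alpha> v\<alpha> by blast
    next
      case False
      have "size s = 3" using st(2) by (auto simp: u_def v_def)
      then consider "s = t" | x y where "x \<noteq> y" "s = {#x, x, y#}" "t = {#x, y, y#}"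
        using False st(1) by (auto simp: length4_swap_theory_def length4_theory_def)
      then show ?thesis
      proof cases
        case (2 x y)
        have "v = {#1, 1, 0#}" by (simp add: v_def add_mset_commute)
        then have "(x = 0 \<and> y = 1) \<or> (x = 1 \<and> y = 0)"
          using st(2) 2 swap_pair_eq[of x y 0 1] swap_pair_eq[of x y 1 0] unfolding u_def by auto
        then show ?thesis using 2(3) by (auto simp: u_def v_def add_mset_commute)
      qed (use st(2) in simp)
    qed
  qed simp
  have uv\<gamma>: "(u, v) \<notin> ?\<gamma>"
  proof
    assume "(u, v) \<in> ?\<gamma>"
    then obtain a b where "u + repeat_mset d a = v + repeat_mset d b"
      by (auto simp: exponents_mod_theory_def)
    then have "count (u + repeat_mset d a) 0 = count (v + repeat_mset d b) 0" by simp
    then have "2 + d * count a 0 = 1 + d * count b 0" by (simp add: u_def v_def)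
    then have "d * count a 0 + 1 = d * count b 0" by linarith
    then have "d dvd 1" by (metis dvd_add_right_iff dvd_triv_left)
    then show False using p(2) by (simp add: d_def)
  qed
  have stay: "w = u" if "(u, w) \<in> join_theory \<alpha> (?\<beta> \<inter> ?\<gamma>)" for w
  proof -
    have path: "(u, w) \<in> (\<alpha> \<union> ?\<beta> \<inter> ?\<gamma>)\<^sup>+" using that by (simp add: join_theory_def)
    have "w \<in> {u}"
      by (rule trancl_stays[OF path]) (use u\<alpha> \<beta>u uv\<gamma> in blast)+
    then show ?thesis by simp
  qed
  \<comment> \<open>\<open>b \<equiv> 1\<close> and \<open>b + r\<^sup>2 = 2 + d(p + r - 1) \<equiv> 2\<close> modulo \<open>d = r + 1\<close>.\<close>
  define b where "b = 1 + d * p"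
  have bp: "b = p + (b - p)" by (simp add: b_def d_def)
  have shift: "(repeat_mset b X, repeat_mset b X + repeat_mset (r * r) X) \<in> \<alpha>" if X: "X \<noteq> {#}" for X
  proof -
    have "(repeat_mset p X, repeat_mset p X + repeat_mset r (repeat_mset r X)) \<in> \<alpha>"
      by (rule theory_iterate[OF \<alpha> p(3)[OF X]])
    then have "(repeat_mset p X + repeat_mset (b - p) X,
        repeat_mset p X + repeat_mset r (repeat_mset r X) + repeat_mset (b - p) X) \<in> \<alpha>"
      by (rule theory_add[OF \<alpha>])
    moreover have e: "repeat_mset p X + repeat_mset (b - p) X = repeat_mset b X"
      by (subst (2) bp) (simp only: repeat_mset_distrib)
    moreover have "repeat_mset p X + repeat_mset r (repeat_mset r X) + repeat_mset (b - p) X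
        = repeat_mset b X + repeat_mset (r * r) X"
      by (simp add: e[symmetric] ac_simps)
    ultimately show ?thesis by (simp only:)
  qed
  define w where "w = repeat_mset (b + r * r) {#0::nat#} + repeat_mset b {#1#}"
  define w' where "w' = repeat_mset b {#0::nat#} + repeat_mset (b + r * r) {#1#}"
  have fw: "substitute f w = w'" by (simp add: w_def w'_def f_def ac_simps)
  have 1: "(repeat_mset b {#0::nat#} + repeat_mset b {#1#}, w) \<in> \<alpha>"
    using theory_add[OF \<alpha> shift[of "{#0#}"], of "repeat_mset b {#1#}"]
    by (simp add: w_def repeat_mset_distrib replicate_mset_plus)
  have "(substitute f (repeat_mset b {#0::nat#} + repeat_mset b {#1#}), substitute f w) \<in> \<alpha>"
    by (rule theory_substitute[OF \<alpha> 1]) (simp add: f_def)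
  then have "(repeat_mset b {#0::nat#} + repeat_mset b {#1#}, w') \<in> \<alpha>"
    by (simp add: fw) (simp add: f_def add.commute)
  then have ww': "(w, w') \<in> \<alpha>" using theory_trans[OF \<alpha> theory_sym[OF \<alpha> 1]] by blast
  have uw: "(u, w) \<in> ?\<gamma>"
  proof -
    obtain r' where r': "r = Suc r'" using p(2) by (cases r) auto
    have "b + r * r = 2 + d * (p + r')" by (simp add: b_def d_def r' algebra_simps)
    then have "u + repeat_mset d (repeat_mset (p + r') {#0#} + repeat_mset p {#1#}) = w + repeat_mset d {#}"
      unfolding w_def u_def by (intro multiset_eqI) (auto simp: b_def)
    moreover have "u \<noteq> {#}" "w \<noteq> {#}" by (simp_all add: u_def w_def b_def)
    ultimately show ?thesis unfolding exponents_mod_theory_def by blast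
  qed
  have "(substitute f u, substitute f w) \<in> ?\<gamma>"
    by (rule theory_substitute[OF \<gamma> uw]) (simp add: f_def)
  then have "(w', v) \<in> ?\<gamma>" using theory_sym[OF \<gamma>] fuv fw by simp
  then have "(u, v) \<in> join_theory \<alpha> ?\<gamma>"
    using uw ww' unfolding join_theory_def by (meson UnI1 UnI2 trancl.intros)
  moreover have "(u, v) \<in> ?\<beta>" using swap join_theory_upper(2) by blast
  ultimately have "v = u" using stay eq by blast
  then have "count u 0 = count v 0" by simp
  then show False by (simp add: u_def v_def)
qed

text \<open>If \<open>x\<^sup>2y\<close> equals a long word \<open>i\<close> in \<open>\<alpha>\<close>, then \<open>xy\<^sup>2\<close> equals the mirror image of \<open>i\<close>, so the join of
  \<open>\<alpha>\<close> with \<open>length4_theory\<close> contains \<open>x\<^sup>2y = xy\<^sup>2\<close>. By modularity this identity is reached using only the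
  part of \<open>\<alpha>\<close> inside \<open>length4_swap_theory\<close>, which relates \<open>x\<^sup>2y\<close> to no other word than \<open>xy\<^sup>2\<close>.\<close>

lemma modular_swaps:
  assumes \<alpha>: "comm_theory \<alpha>" and m: "modular_theory \<alpha>" and r: "reaches_bulky \<alpha> {#0, 0, 1#}"
  shows "swaps_squares \<alpha>"
proof -
  define u v where "u = {#0, 0, 1 :: nat#}" and "v = {#0, 1, 1 :: nat#}"
  define f where "f = (\<lambda>c::nat. {#c#})(0 := {#1#}, 1 := {#0#})"
  have fu: "substitute f u = v" by (simp add: f_def u_def v_def add_mset_commute)
  obtain i where i: "bulky i" "(u, i) \<in> \<alpha>" using r by (auto simp: reaches_bulky_def u_def)
  have "(substitute f u, substitute f i) \<in> \<alpha>"
    by (rule theory_substitute[OF \<alpha> i(2)]) (simp add: f_def)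
  then have v: "(substitute f i, v) \<in> \<alpha>" using theory_sym[OF \<alpha>] fu by simp
  have "bulky (substitute f i)" by (rule bulky_substitute[OF i(1)]) (simp add: f_def)
  then have "(i, substitute f i) \<in> length4_theory"
    using i(1) bulky_nonempty by (auto simp: length4_theory_def bulky_def)
  then have "(u, v) \<in> join_theory \<alpha> length4_theory"
    using i(2) v unfolding join_theory_def by (meson UnI1 UnI2 trancl.intros)
  moreover have "(u, v) \<in> length4_swap_theory"
    unfolding length4_swap_theory_def u_def v_def by (intro UnI2 CollectI exI[of _ 0] exI[of _ 1]) simp
  moreover have "join_theory (\<alpha> \<inter> length4_swap_theory) length4_theory
      = join_theory \<alpha> length4_theory \<inter> length4_swap_theory"
    using m comm_theory_length4 comm_theory_length4_swap
    unfolding modular_theory_def length4_swap_theory_def by blast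
  ultimately have path: "(u, v) \<in> (\<alpha> \<inter> length4_swap_theory \<union> length4_theory)\<^sup>+"
    by (auto simp: join_theory_def)
  have "(u, v) \<in> \<alpha>"
  proof (rule ccontr)
    assume contra: "(u, v) \<notin> \<alpha>"
    have step: "t = u" if st: "(u, t) \<in> \<alpha> \<inter> length4_swap_theory \<union> length4_theory" for t
    proof -
      have "size u = 3" by (simp add: u_def)
      then consider "t = u" | x y where "x \<noteq> y" "u = {#x, x, y#}" "t = {#x, y, y#}" "(u, t) \<in> \<alpha>"
        using st by (auto simp: length4_swap_theory_def length4_theory_def)
      then show ?thesis
      proof cases
        case (2 x y)
        then have "x = 0 \<and> y = 1" using swap_pair_eq[of x y 0 1] unfolding u_def by simp
        then show ?thesis using 2(3,4) contra by (simp add: v_def)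
      qed
    qed
    have "v \<in> {u}" by (rule trancl_stays[OF path]) (use step in blast)+
    then have "count u 0 = count v 0" by simp
    then show False by (simp add: u_def v_def)
  qed
  then show ?thesis
    using swaps_squaresI[OF \<alpha>, of 0 1] by (simp add: u_def v_def)
qed

lemma modular_lower_modular_swaps:
  assumes \<alpha>: "comm_theory \<alpha>" and m: "modular_theory \<alpha>" and lm: "lower_modular_theory \<alpha>"
    and ne: "\<alpha> \<noteq> equality_theory"
  shows "swaps_squares \<alpha>"
proof -
  obtain w where w: "w \<noteq> {#0, 0, 1#}" "({#0, 0, 1#}, w) \<in> \<alpha>"
    using lower_modular_moves[OF \<alpha> lm ne] by blast
  then consider "reaches_bulky \<alpha> {#0, 0, 1#}"
    | x y where "x \<noteq> y" "{#0, 0, 1#} = {#x, x, y#}" "w = {#x, y, y#}"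
    using theory_pair_cases[OF \<alpha> w(2)] by metis
  then show ?thesis
  proof cases
    case 1
    then show ?thesis by (rule modular_swaps[OF \<alpha> m])
  next
    case (2 x y)
    then show ?thesis using swaps_squaresI[OF \<alpha> _ 2(1)] w(2) by simp
  qed
qed

lemma standard_iff_swaps_squares:
  assumes \<alpha>: "comm_theory \<alpha>"
  shows "modular_theory \<alpha> \<and> lower_modular_theory \<alpha> \<longleftrightarrow> standard_theory \<alpha>"
    and "standard_theory \<alpha> \<longleftrightarrow> \<alpha> = equality_theory \<or> swaps_squares \<alpha>"
  using modular_lower_modular_swaps[OF \<alpha>] swaps_squares_standard[OF \<alpha>] equality_theory_standard
    standard_modular[of \<alpha>] standard_lower_modular[of \<alpha>] by blast+

section \<open>Splitting off the semilattices\<close>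

text \<open>The commutative theory axiomatized by \<open>x\<^sup>2yz = 0\<close>.\<close>

definition bulky_theory :: "(nat multiset \<times> nat multiset) set" where
  "bulky_theory = {(u, v). u \<noteq> {#} \<and> v \<noteq> {#} \<and> (u = v \<or> bulky u \<and> bulky v)}"

lemma comm_theory_bulky: "comm_theory bulky_theory"
proof (rule comm_theoryI)
  fix u v and f :: "nat \<Rightarrow> nat multiset"
  assume "(u, v) \<in> bulky_theory" "\<forall>x. f x \<noteq> {#}"
  then show "(substitute f u, substitute f v) \<in> bulky_theory"
    using bulky_substitute[of u f] bulky_substitute[of v f] substitute_nonempty[of u f]
      substitute_nonempty[of v f] by (auto simp: bulky_theory_def)
next
  fix u v t assume "(u, v) \<in> bulky_theory"
  then show "(u + t, v + t) \<in> bulky_theory"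
    using bulky_add[of u t] bulky_add[of v t] by (auto simp: bulky_theory_def)
qed (auto simp: bulky_theory_def)

text \<open>Joining with \<open>bulky_theory\<close> creates new identities only between words equal to bulky ones, and of
  these \<open>\<alpha>\<close> already contains all that preserve the content.\<close>

lemma content_split:
  assumes \<alpha>: "comm_theory \<alpha>" and sw: "swaps_squares \<alpha>" and c: "\<alpha> \<subseteq> content_theory"
  shows "\<alpha> = content_theory \<inter> join_theory \<alpha> bulky_theory"
proof (intro subset_antisym subsetI)
  show "e \<in> content_theory \<inter> join_theory \<alpha> bulky_theory" if "e \<in> \<alpha>" for e
    using that c join_theory_upper by blast
  fix e assume e: "e \<in> content_theory \<inter> join_theory \<alpha> bulky_theory"
  obtain u v where uv: "e = (u, v)" by (cases e)
  have path: "(u, v) \<in> (\<alpha> \<union> bulky_theory)\<^sup>+" using e by (simp add: uv join_theory_def)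
  \<comment> \<open>Along a path from \<open>u\<close> either no step leaves \<open>\<alpha>\<close>, or all words passed are linked to bulky ones.\<close>
  define A where "A = {w. (u, w) \<in> \<alpha> \<or> reaches_bulky \<alpha> u \<and> reaches_bulky \<alpha> w}"
  have "v \<in> A"
  proof (rule trancl_stays[OF path])
    have "u \<noteq> {#}" using e by (simp add: uv content_theory_def)
    then show "u \<in> A" using theory_refl[OF \<alpha>] by (simp add: A_def)
    fix s t assume st: "(s, t) \<in> \<alpha> \<union> bulky_theory" "s \<in> A"
    show "t \<in> A"
    proof (cases "(s, t) \<in> \<alpha>")
      case True
      then show ?thesis
        using st(2) theory_trans[OF \<alpha>, of u s t] reaches_bulky_trans[OF \<alpha> theory_sym[OF \<alpha> True]]
        by (auto simp: A_def)
    next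
      case False
      then have "s = t \<or> bulky s \<and> bulky t" using st(1) by (auto simp: bulky_theory_def)
      then show ?thesis
      proof
        assume b: "bulky s \<and> bulky t"
        then have "reaches_bulky \<alpha> s" "reaches_bulky \<alpha> t" using bulky_reaches[OF \<alpha>] by blast+
        then show ?thesis using st(2) reaches_bulky_trans[OF \<alpha>, of u s] by (auto simp: A_def)
      qed (use st(2) in simp)
    qed
  qed
  then consider "(u, v) \<in> \<alpha>" | i j where "bulky i" "(u, i) \<in> \<alpha>" "bulky j" "(v, j) \<in> \<alpha>"
    by (auto simp: A_def reaches_bulky_def)
  then show "e \<in> \<alpha>"
  proof cases
    case (2 i j)
    have "set_mset i = set_mset u" "set_mset j = set_mset v"
      using c 2 by (auto simp: content_theory_def)
    then have "set_mset i = set_mset j" using e by (simp add: uv content_theory_def)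
    then have "(i, j) \<in> \<alpha>" by (rule bulky_same_content[OF \<alpha> sw 2(1,3)])
    then show ?thesis
      unfolding uv using theory_trans[OF \<alpha> theory_trans[OF \<alpha> 2(2)] theory_sym[OF \<alpha> 2(4)]] by blast
  qed (simp add: uv)
qed

section \<open>Evaluation of words in commutative semigroups\<close>

lemma word_value_Cons: "w \<noteq> [] \<Longrightarrow> word_value S h (x # w) = h x \<cdot>\<^bsub>S\<^esub> word_value S h w"
  by (cases w) auto

lemma word_value_closed:
  assumes "is_semigroup S" "h \<in> UNIV \<rightarrow> carrier S"
  shows "u \<noteq> [] \<Longrightarrow> word_value S h u \<in> carrier S"
proof (induction u rule: list_nonempty_induct)
  case (cons x u)
  have "h x \<in> carrier S" using assms(2) by auto
  then show ?case
    using assms(1) cons by (simp add: word_value_Cons is_semigroup_def)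
qed (use assms in auto)

lemma word_value_append:
  assumes S: "is_semigroup S" and h: "h \<in> UNIV \<rightarrow> carrier S" and v: "v \<noteq> []"
  shows "u \<noteq> [] \<Longrightarrow> word_value S h (u @ v) = word_value S h u \<cdot>\<^bsub>S\<^esub> word_value S h v"
proof (induction u rule: list_nonempty_induct)
  case (single x)
  then show ?case using v by (simp add: word_value_Cons)
next
  case (cons x u)
  have "h x \<in> carrier S" using h by auto
  then show ?case
    using S cons word_value_closed[OF S h cons(1)] word_value_closed[OF S h v]
    by (simp add: word_value_Cons is_semigroup_def)
qed

lemma word_value_concat:
  assumes S: "is_semigroup S" and h: "h \<in> UNIV \<rightarrow> carrier S" and g: "\<And>x. g x \<noteq> []"
  shows "u \<noteq> [] \<Longrightarrow> word_value S h (concat (map g u)) = word_value S (\<lambda>x. word_value S h (g x)) u"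
proof (induction u rule: list_nonempty_induct)
  case (cons x u)
  have "concat (map g u) \<noteq> []" using cons(1) g by (cases u) auto
  then show ?case using cons word_value_append[OF S h _ g] by (simp add: word_value_Cons)
qed simp

lemma COM_semigroup: "S \<in> COM_variety \<Longrightarrow> is_semigroup S"
  by (simp add: COM_variety_def variety_of_def)

lemma COM_commute:
  assumes "S \<in> COM_variety" "a \<in> carrier S" "b \<in> carrier S"
  shows "a \<cdot>\<^bsub>S\<^esub> b = b \<cdot>\<^bsub>S\<^esub> a"
proof -
  define h where "h n = (if n = 0 then a else b)" for n :: nat
  have "h \<in> UNIV \<rightarrow> carrier S" using assms by (simp add: h_def)
  moreover have "satisfies S ([0, 1], [1, 0])"
    using assms(1) by (simp add: COM_variety_def variety_of_def)
  ultimately have "word_value S h [0, 1] = word_value S h [1, 0]"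
    unfolding satisfies_def by simp
  then show ?thesis by (simp add: h_def)
qed

lemma word_value_mset:
  assumes S: "S \<in> COM_variety" and h: "h \<in> UNIV \<rightarrow> carrier S"
  shows "u \<noteq> [] \<Longrightarrow> mset u = mset v \<Longrightarrow> word_value S h u = word_value S h v"
proof (induction u arbitrary: v rule: list_nonempty_induct)
  case (single x)
  then have "v = [x]" by (metis mset_single_iff)
  then show ?case by simp
next
  case (cons x u)
  note sg = COM_semigroup[OF S]
  have "x \<in> set v" using cons(3) by (metis list.set_intros(1) set_mset_mset)
  then obtain a b where v: "v = a @ x # b" by (auto dest: split_list)
  then have ab: "mset u = mset (a @ b)" using cons(3) by simp
  then have "a @ b \<noteq> []" using cons(1) by auto
  have u: "word_value S h u = word_value S h (a @ b)" by (rule cons(2)[OF ab])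
  have hx: "h x \<in> carrier S" using h by auto
  note cl = word_value_closed[OF sg h]
  have "word_value S h v = h x \<cdot>\<^bsub>S\<^esub> word_value S h (a @ b)"
  proof (cases "a = []")
    case True
    then show ?thesis using v \<open>a @ b \<noteq> []\<close> by (simp add: word_value_Cons)
  next
    case a: False
    have "word_value S h v = word_value S h a \<cdot>\<^bsub>S\<^esub> word_value S h (x # b)"
      unfolding v by (rule word_value_append[OF sg h _ a]) simp
    also have "\<dots> = h x \<cdot>\<^bsub>S\<^esub> word_value S h (a @ b)"
    proof (cases "b = []")
      case True
      then show ?thesis using COM_commute[OF S cl[OF a] hx] by simp
    next
      case b: False
      have "word_value S h a \<cdot>\<^bsub>S\<^esub> (h x \<cdot>\<^bsub>S\<^esub> word_value S h b)
          = (word_value S h a \<cdot>\<^bsub>S\<^esub> h x) \<cdot>\<^bsub>S\<^esub> word_value S h b"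
        using sg cl[OF a] cl[OF b] hx by (simp add: is_semigroup_def)
      also have "\<dots> = (h x \<cdot>\<^bsub>S\<^esub> word_value S h a) \<cdot>\<^bsub>S\<^esub> word_value S h b"
        using COM_commute[OF S cl[OF a] hx] by simp
      also have "\<dots> = h x \<cdot>\<^bsub>S\<^esub> (word_value S h a \<cdot>\<^bsub>S\<^esub> word_value S h b)"
        using sg cl[OF a] cl[OF b] hx by (simp add: is_semigroup_def)
      finally show ?thesis
        using b word_value_append[OF sg h b a] by (simp add: word_value_Cons)
    qed
    finally show ?thesis .
  qed
  then show ?case using u cons(1) by (simp add: word_value_Cons)
qed

lemma satisfies_mset:
  assumes "S \<in> COM_variety" "u \<noteq> []" "v \<noteq> []" "mset u = mset u'" "mset v = mset v'"
  shows "satisfies S (u, v) \<longleftrightarrow> satisfies S (u', v')"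
  using word_value_mset[OF assms(1) _ assms(2,4)] word_value_mset[OF assms(1) _ assms(3,5)]
  by (simp add: satisfies_def)

section \<open>Varieties and theories\<close>

definition theory_of :: "'u sgrp set \<Rightarrow> (nat multiset \<times> nat multiset) set" where
  "theory_of V = {(mset u, mset v) |u v. u \<noteq> [] \<and> v \<noteq> [] \<and> (\<forall>S\<in>V. satisfies S (u, v))}"

definition models_of :: "(nat multiset \<times> nat multiset) set \<Rightarrow> 'u sgrp set" where
  "models_of \<theta> = variety_of {(u, v). u \<noteq> [] \<and> v \<noteq> [] \<and> (mset u, mset v) \<in> \<theta>}"

lemma theory_of_iff:
  assumes "V \<subseteq> COM_variety" "u \<noteq> []" "v \<noteq> []"
  shows "(mset u, mset v) \<in> theory_of V \<longleftrightarrow> (\<forall>S\<in>V. satisfies S (u, v))"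
proof
  assume "(mset u, mset v) \<in> theory_of V"
  then obtain u' v' where uv: "mset u = mset u'" "mset v = mset v'"
    and sat: "\<forall>S\<in>V. satisfies S (u', v')"
    by (auto simp: theory_of_def)
  show "\<forall>S\<in>V. satisfies S (u, v)"
    using sat satisfies_mset[OF _ assms(2,3) uv] assms(1) by blast
qed (use assms in \<open>auto simp: theory_of_def\<close>)

lemma theory_of_cases:
  assumes "V \<subseteq> COM_variety" "(a, b) \<in> theory_of V"
  obtains u v where "a = mset u" "b = mset v" "u \<noteq> []" "v \<noteq> []" "\<And>S. S \<in> V \<Longrightarrow> satisfies S (u, v)"
  using assms(2) by (auto simp: theory_of_def)

lemma comm_theory_theory_of:
  fixes V :: "'u sgrp set"
  assumes V: "V \<subseteq> COM_variety"
  shows "comm_theory (theory_of V)"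
proof (rule comm_theoryI)
  fix a b assume ab: "(a, b) \<in> theory_of V"
  obtain u v where uv: "a = mset u" "b = mset v" "u \<noteq> []" "v \<noteq> []"
    and sat: "\<And>S. S \<in> V \<Longrightarrow> satisfies S (u, v)"
    using theory_of_cases[OF V ab] by blast
  show "a \<noteq> {#} \<and> b \<noteq> {#}" using uv by simp
  have "satisfies S (v, u)" if "S \<in> V" for S using sat[OF that] by (simp add: satisfies_def)
  then show "(b, a) \<in> theory_of V" unfolding uv using theory_of_iff[OF V uv(4,3)] by blast
  show "(a + t, b + t) \<in> theory_of V" for t
  proof (cases "t = {#}")
    case False
    obtain w where w: "t = mset w" using ex_mset by metis
    with False have "w \<noteq> []" by auto
    have "satisfies S (u @ w, v @ w)" if S: "S \<in> V" for S
    proof -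
      have "is_semigroup S" using V S COM_semigroup by blast
      then show ?thesis
        using sat[OF S] word_value_append[of S _ w] \<open>w \<noteq> []\<close> uv by (simp add: satisfies_def)
    qed
    moreover have "u @ w \<noteq> []" "v @ w \<noteq> []" using uv by auto
    ultimately have "(mset (u @ w), mset (v @ w)) \<in> theory_of V" using theory_of_iff[OF V] by blast
    then show ?thesis by (simp add: uv w)
  qed (use ab in simp)
  show "(substitute f a, substitute f b) \<in> theory_of V" if f: "\<forall>x. f x \<noteq> {#}" for f
  proof -
    have "\<forall>x. \<exists>w. mset w = f x" using ex_mset by blast
    then obtain g where g: "\<And>x. mset (g x) = f x" by metis
    have gne: "g x \<noteq> []" for x using f g[of x] by (metis mset.simps(1))
    have con: "mset (concat (map g w)) = substitute f (mset w)" for w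
      by (induction w) (simp_all add: g)
    have ne: "concat (map g w) \<noteq> []" if "w \<noteq> []" for w
      using that gne by (cases w) auto
    have "satisfies S (concat (map g u), concat (map g v))" if S: "S \<in> V" for S
      unfolding satisfies_def
    proof
      fix h :: "nat \<Rightarrow> 'u" assume h: "h \<in> UNIV \<rightarrow> carrier S"
      have sg: "is_semigroup S" using V S COM_semigroup by blast
      have "(\<lambda>x. word_value S h (g x)) \<in> UNIV \<rightarrow> carrier S"
        using word_value_closed[OF sg h gne] by simp
      then show "word_value S h (fst (concat (map g u), concat (map g v)))
          = word_value S h (snd (concat (map g u), concat (map g v)))"
        using sat[OF S] word_value_concat[OF sg h gne uv(3)] word_value_concat[OF sg h gne uv(4)]
        by (simp add: satisfies_def)
    qed
    then show ?thesis
      using theory_of_iff[OF V ne[OF uv(3)] ne[OF uv(4)]] unfolding con uv by blast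
  qed
next
  fix a :: "nat multiset" assume "a \<noteq> {#}"
  moreover obtain u where "a = mset u" using ex_mset by metis
  ultimately show "(a, a) \<in> theory_of V"
    using theory_of_iff[OF V, of u u] by (auto simp: satisfies_def)
next
  fix a b c assume ab: "(a, b) \<in> theory_of V" and bc: "(b, c) \<in> theory_of V"
  obtain u v where uv: "a = mset u" "b = mset v" "u \<noteq> []" "v \<noteq> []"
    and sat: "\<And>S. S \<in> V \<Longrightarrow> satisfies S (u, v)"
    using theory_of_cases[OF V ab] by blast
  obtain v' w where vw: "b = mset v'" "c = mset w" "v' \<noteq> []" "w \<noteq> []"
    using theory_of_cases[OF V bc] by blast
  have "\<forall>S\<in>V. satisfies S (v, w)" using bc theory_of_iff[OF V uv(4) vw(4)] uv(2) vw(2) by simp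
  then have "satisfies S (u, w)" if "S \<in> V" for S
    using sat[OF that] that by (simp add: satisfies_def)
  then show "(a, c) \<in> theory_of V"
    unfolding uv vw using theory_of_iff[OF V uv(3) vw(4)] by blast
qed

lemma theory_of_antimono: "V \<subseteq> W \<Longrightarrow> theory_of W \<subseteq> theory_of V"
  by (auto simp: theory_of_def)

lemma models_of_antimono: "\<alpha> \<subseteq> \<beta> \<Longrightarrow> models_of \<beta> \<subseteq> models_of \<alpha>"
  by (auto simp: models_of_def variety_of_def)

lemma Com_carrier: "V \<in> carrier Com \<longleftrightarrow> is_variety V \<and> V \<subseteq> COM_variety"
  by (simp add: Com_def commutative_variety_iff)

lemma models_of_Com:
  assumes "comm_theory \<theta>"
  shows "models_of \<theta> \<in> carrier Com"
  unfolding Com_carrier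
proof
  show "is_variety (models_of \<theta>)"
    unfolding models_of_def by (rule is_varietyI) (auto simp: semigroup_identities_def)
  have "({#0, 1#}, {#0, 1#}) \<in> \<theta>" by (rule theory_refl[OF assms]) simp
  then show "models_of \<theta> \<subseteq> COM_variety"
    by (auto simp: models_of_def COM_variety_def variety_of_def add_mset_commute)
qed

lemma models_of_theory_of:
  assumes "V \<in> carrier Com"
  shows "models_of (theory_of V) = V"
proof
  have V: "V \<subseteq> COM_variety" "is_variety V" using assms by (auto simp: Com_carrier)
  obtain \<Sigma> where \<Sigma>: "\<Sigma> \<subseteq> semigroup_identities" "V = variety_of \<Sigma>" using V(2) by (rule is_varietyE)
  show "V \<subseteq> models_of (theory_of V)"
  proof
    fix S assume S: "S \<in> V"
    then have "is_semigroup S" using V COM_semigroup by blast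
    then show "S \<in> models_of (theory_of V)"
      using S theory_of_iff[OF V(1)] by (auto simp: models_of_def variety_of_def)
  qed
  have "(u, v) \<in> \<Sigma> \<Longrightarrow> u \<noteq> [] \<and> v \<noteq> [] \<and> (mset u, mset v) \<in> theory_of V" for u v
    using \<Sigma> unfolding theory_of_def semigroup_identities_def variety_of_def by blast
  then show "models_of (theory_of V) \<subseteq> V"
    unfolding models_of_def \<Sigma>(2) variety_of_def by auto
qed

text \<open>The free semigroup of the theory is countable, so it can be coded inside any infinite type. An
  element of the carrier is the code \<open>c a\<close> of a chosen representative of the class of \<open>a\<close>, and \<open>d\<close> is
  a section of \<open>c\<close>.\<close>

lemma free_model:
  assumes inf: "infinite (UNIV :: 'u set)" and \<theta>: "comm_theory \<theta>"
  obtains S :: "'u sgrp" and c where "S \<in> models_of \<theta>"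
    "\<And>a. a \<noteq> {#} \<Longrightarrow> c a \<in> carrier S"
    "\<And>u. u \<noteq> [] \<Longrightarrow> word_value S (\<lambda>x. c {#x#}) u = c (mset u)"
    "\<And>a b. a \<noteq> {#} \<Longrightarrow> b \<noteq> {#} \<Longrightarrow> c a = c b \<Longrightarrow> (a, b) \<in> \<theta>"
proof -
  obtain e :: "nat \<Rightarrow> 'u" where e: "inj e" using infinite_countable_subset[OF inf] by blast
  define j where "j a = e (to_nat (sorted_list_of_multiset a))" for a :: "nat multiset"
  have j: "a = b" if "j a = j b" for a b
  proof -
    have "sorted_list_of_multiset a = sorted_list_of_multiset b"
      using that by (simp add: j_def inj_eq[OF e])
    then show ?thesis by (metis mset_sorted_list_of_multiset)
  qed
  define rep where "rep a = (SOME b. (a, b) \<in> \<theta>)" for a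
  have rep: "(a, rep a) \<in> \<theta>" if "a \<noteq> {#}" for a
    unfolding rep_def by (rule someI[of _ a]) (rule theory_refl[OF \<theta> that])
  have rep_eq: "rep a = rep b" if "(a, b) \<in> \<theta>" for a b
  proof -
    have "(a, z) \<in> \<theta> \<longleftrightarrow> (b, z) \<in> \<theta>" for z
      using theory_trans[OF \<theta> that] theory_trans[OF \<theta> theory_sym[OF \<theta> that]] by blast
    then show ?thesis by (simp add: rep_def)
  qed
  define c where "c a = j (rep a)" for a
  have c_eq: "c a = c b" if "(a, b) \<in> \<theta>" for a b using rep_eq[OF that] by (simp add: c_def)
  have c_inj: "(a, b) \<in> \<theta>" if "a \<noteq> {#}" "b \<noteq> {#}" "c a = c b" for a b
  proof -
    have "rep a = rep b" using j that(3) by (simp add: c_def)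
    then show ?thesis using theory_trans[OF \<theta> rep[OF that(1)]] theory_sym[OF \<theta> rep[OF that(2)]] by simp
  qed
  define d where "d s = (SOME a. a \<noteq> {#} \<and> c a = s)" for s
  have d: "d s \<noteq> {#} \<and> c (d s) = s" if "s \<in> c ` {a. a \<noteq> {#}}" for s
    unfolding d_def by (rule someI_ex) (use that in blast)
  define S where "S = \<lparr>carrier = c ` {a. a \<noteq> {#}}, sgrp_mult = (\<lambda>s t. c (d s + d t))\<rparr>"
  have carrier: "carrier S = c ` {a. a \<noteq> {#}}" by (simp add: S_def)
  have mult: "c a \<cdot>\<^bsub>S\<^esub> c b = c (a + b)" if ne: "a \<noteq> {#}" "b \<noteq> {#}" for a b
  proof -
    have da: "(d (c a), a) \<in> \<theta>" and db: "(d (c b), b) \<in> \<theta>"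
      using c_inj d ne by blast+
    have "(d (c a) + d (c b), a + d (c b)) \<in> \<theta>" by (rule theory_add[OF \<theta> da])
    moreover have "(d (c b) + a, b + a) \<in> \<theta>" by (rule theory_add[OF \<theta> db])
    then have "(a + d (c b), a + b) \<in> \<theta>" by (simp add: add.commute)
    ultimately have "(d (c a) + d (c b), a + b) \<in> \<theta>" by (rule theory_trans[OF \<theta>])
    from c_eq[OF this] show ?thesis by (simp add: S_def)
  qed
  have sg: "is_semigroup S"
    unfolding is_semigroup_def
  proof (intro conjI ballI)
    have "c {#0#} \<in> carrier S" unfolding carrier by simp
    then show "carrier S \<noteq> {}" by blast
    fix s t assume st: "s \<in> carrier S" "t \<in> carrier S"
    obtain a where a: "a \<noteq> {#}" "s = c a" using st(1) unfolding carrier by blast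
    obtain b where b: "b \<noteq> {#}" "t = c b" using st(2) unfolding carrier by blast
    note ab = a(1) b(1) a(2) b(2)
    have "s \<cdot>\<^bsub>S\<^esub> t = c (a + b)" "a + b \<noteq> {#}" using ab mult[OF ab(1,2)] by simp_all
    then show "s \<cdot>\<^bsub>S\<^esub> t \<in> carrier S" unfolding carrier by blast
    fix r assume "r \<in> carrier S"
    then obtain z where "z \<noteq> {#}" "r = c z" unfolding carrier by blast
    then show "s \<cdot>\<^bsub>S\<^esub> t \<cdot>\<^bsub>S\<^esub> r = s \<cdot>\<^bsub>S\<^esub> (t \<cdot>\<^bsub>S\<^esub> r)"
      unfolding ab(3,4) by (simp add: mult ab(1,2) add.assoc)
  qed
  have val: "word_value S (\<lambda>x. c (f x)) u = c (substitute f (mset u))"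
    if f: "\<And>x. f x \<noteq> {#}" and "u \<noteq> []" for f u
    using that(2)
  proof (induction u rule: list_nonempty_induct)
    case (cons x u)
    have "substitute f (mset u) \<noteq> {#}" using cons(1) f by (intro substitute_nonempty) auto
    then show ?case using cons f by (simp add: word_value_Cons mult)
  qed simp
  have "satisfies S (u, v)" if uv: "u \<noteq> []" "v \<noteq> []" "(mset u, mset v) \<in> \<theta>" for u v
    unfolding satisfies_def
  proof
    fix h :: "nat \<Rightarrow> 'u" assume h: "h \<in> UNIV \<rightarrow> carrier S"
    have f: "d (h x) \<noteq> {#} \<and> c (d (h x)) = h x" for x using h d carrier by blast
    have hf: "h = (\<lambda>x. c (d (h x)))" using f by simp
    have "(substitute (\<lambda>x. d (h x)) (mset u), substitute (\<lambda>x. d (h x)) (mset v)) \<in> \<theta>"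
      by (rule theory_substitute[OF \<theta> uv(3)]) (use f in blast)
    then have "word_value S (\<lambda>x. c (d (h x))) u = word_value S (\<lambda>x. c (d (h x))) v"
      using val[of "\<lambda>x. d (h x)", OF _ uv(1)] val[of "\<lambda>x. d (h x)", OF _ uv(2)] f
        c_eq[of "substitute (\<lambda>x. d (h x)) (mset u)" "substitute (\<lambda>x. d (h x)) (mset v)"] by simp
    then show "word_value S h (fst (u, v)) = word_value S h (snd (u, v))"
      using hf by simp
  qed
  then have "S \<in> models_of \<theta>" using sg by (auto simp: models_of_def variety_of_def)
  moreover have "c a \<in> carrier S" if "a \<noteq> {#}" for a using that carrier by blast
  moreover have "word_value S (\<lambda>x. c {#x#}) u = c (mset u)" if "u \<noteq> []" for u
    using val[of "\<lambda>x. {#x#}", OF _ that] substitute_fixed[of "mset u" "\<lambda>x. {#x#}"] by simp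
  ultimately show ?thesis using that c_inj by blast
qed

section \<open>Transfer to the lattice of commutative varieties\<close>

context
  assumes infinite_type: "infinite (UNIV :: 'u set)"
begin

text \<open>Completeness of equational logic for commutative semigroups. With
  \<open>models_of_theory_of\<close> it makes the lattice of commutative varieties dual to that of theories.\<close>

lemma theory_of_models_of:
  assumes \<theta>: "comm_theory \<theta>"
  shows "theory_of (models_of \<theta> :: 'u sgrp set) = \<theta>"
proof (intro subset_antisym subrelI)
  have COM: "(models_of \<theta> :: 'u sgrp set) \<subseteq> COM_variety"
    using models_of_Com[OF \<theta>] by (auto simp: Com_carrier)
  fix a b
  show "(a, b) \<in> theory_of (models_of \<theta> :: 'u sgrp set)" if ab: "(a, b) \<in> \<theta>"
  proof -
    obtain u v where uv: "a = mset u" "b = mset v" using ex_mset by metis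
    then have "u \<noteq> []" "v \<noteq> []" using theory_nonempty[OF \<theta> ab] by auto
    then show ?thesis
      unfolding uv using theory_of_iff[OF COM] ab uv by (auto simp: models_of_def variety_of_def)
  qed
  assume ab: "(a, b) \<in> theory_of (models_of \<theta> :: 'u sgrp set)"
  obtain u v where uv: "a = mset u" "b = mset v" "u \<noteq> []" "v \<noteq> []"
    and sat: "\<And>S :: 'u sgrp. S \<in> models_of \<theta> \<Longrightarrow> satisfies S (u, v)"
    using theory_of_cases[OF COM ab] by blast
  obtain S :: "'u sgrp" and c where S: "S \<in> models_of \<theta>"
    "\<And>a. a \<noteq> {#} \<Longrightarrow> c a \<in> carrier S"
    "\<And>u. u \<noteq> [] \<Longrightarrow> word_value S (\<lambda>x. c {#x#}) u = c (mset u)"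
    "\<And>a b. a \<noteq> {#} \<Longrightarrow> b \<noteq> {#} \<Longrightarrow> c a = c b \<Longrightarrow> (a, b) \<in> \<theta>"
    using free_model[OF infinite_type \<theta>] by blast
  have "(\<lambda>x. c {#x#}) \<in> UNIV \<rightarrow> carrier S" using S(2) by simp
  then have "word_value S (\<lambda>x. c {#x#}) u = word_value S (\<lambda>x. c {#x#}) v"
    using sat[OF S(1)] by (simp add: satisfies_def)
  then have "c a = c b" using S(3) uv by simp
  then show "(a, b) \<in> \<theta>" using S(4) uv by simp
qed

lemma theory_of_meet:
  fixes V W :: "'u sgrp set"
  assumes V: "V \<in> carrier Com" and W: "W \<in> carrier Com"
  shows "theory_of (V \<sqinter>\<^bsub>Com\<^esub> W) = join_theory (theory_of V) (theory_of W)"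
proof
  have COM: "V \<subseteq> COM_variety" "W \<subseteq> COM_variety" "V \<inter> W \<subseteq> COM_variety"
    using V W by (auto simp: Com_carrier)
  note th = comm_theory_theory_of[OF COM(1)] comm_theory_theory_of[OF COM(2)]
  note J = comm_theory_join[OF th]
  show "join_theory (theory_of V) (theory_of W) \<subseteq> theory_of (V \<sqinter>\<^bsub>Com\<^esub> W)"
    unfolding meet_Com[OF V W]
    by (rule join_theory_least[OF comm_theory_theory_of[OF COM(3)]]) (auto intro!: theory_of_antimono)
  have "models_of (join_theory (theory_of V) (theory_of W)) \<subseteq> V \<inter> W"
    using models_of_antimono[OF join_theory_upper(1)] models_of_antimono[OF join_theory_upper(2)]
      models_of_theory_of[OF V] models_of_theory_of[OF W] by blast
  from theory_of_antimono[OF this]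
  show "theory_of (V \<sqinter>\<^bsub>Com\<^esub> W) \<subseteq> join_theory (theory_of V) (theory_of W)"
    unfolding meet_Com[OF V W] theory_of_models_of[OF J] .
qed

lemma theory_of_join:
  fixes V W :: "'u sgrp set"
  assumes V: "V \<in> carrier Com" and W: "W \<in> carrier Com"
  shows "theory_of (V \<squnion>\<^bsub>Com\<^esub> W) = theory_of V \<inter> theory_of W"
proof
  have COM: "V \<subseteq> COM_variety" "W \<subseteq> COM_variety" using V W by (auto simp: Com_carrier)
  let ?\<theta> = "theory_of V \<inter> theory_of W"
  have \<theta>: "comm_theory ?\<theta>"
    by (rule comm_theory_Int[OF comm_theory_theory_of[OF COM(1)] comm_theory_theory_of[OF COM(2)]])
  have "V \<union> W \<subseteq> V \<squnion>\<^bsub>Com\<^esub> W" unfolding join_Com[OF V W] by blast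
  then show "theory_of (V \<squnion>\<^bsub>Com\<^esub> W) \<subseteq> ?\<theta>"
    using theory_of_antimono[of V "V \<squnion>\<^bsub>Com\<^esub> W"] theory_of_antimono[of W "V \<squnion>\<^bsub>Com\<^esub> W"] by blast
  have "V \<subseteq> models_of ?\<theta>" "W \<subseteq> models_of ?\<theta>"
    using models_of_antimono[of ?\<theta> "theory_of V"] models_of_antimono[of ?\<theta> "theory_of W"]
      models_of_theory_of[OF V] models_of_theory_of[OF W] by blast+
  moreover have "is_variety (models_of ?\<theta> :: 'u sgrp set)"
    using models_of_Com[OF \<theta>] by (auto simp: Com_carrier)
  ultimately have "V \<squnion>\<^bsub>Com\<^esub> W \<subseteq> models_of ?\<theta>" unfolding join_Com[OF V W] by blast
  from theory_of_antimono[OF this] show "?\<theta> \<subseteq> theory_of (V \<squnion>\<^bsub>Com\<^esub> W)"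
    unfolding theory_of_models_of[OF \<theta>] .
qed

lemma theory_of_subset_iff:
  fixes V W :: "'u sgrp set"
  assumes "V \<in> carrier Com" "W \<in> carrier Com"
  shows "theory_of W \<subseteq> theory_of V \<longleftrightarrow> V \<subseteq> W"
  using theory_of_antimono[of V W] models_of_antimono[of "theory_of W" "theory_of V"]
    models_of_theory_of[OF assms(1)] models_of_theory_of[OF assms(2)] by blast

lemma theory_of_eq_iff:
  fixes V W :: "'u sgrp set"
  assumes "V \<in> carrier Com" "W \<in> carrier Com"
  shows "V = W \<longleftrightarrow> theory_of V = theory_of W"
  using models_of_theory_of[OF assms(1)] models_of_theory_of[OF assms(2)] by metis

lemma comm_theory_of_Com: "V \<in> carrier Com \<Longrightarrow> comm_theory (theory_of V)"
  by (simp add: Com_carrier comm_theory_theory_of)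

lemma all_Com_iff:
  "(\<forall>V\<in>carrier Com. P (theory_of (V :: 'u sgrp set))) \<longleftrightarrow> (\<forall>\<theta>. comm_theory \<theta> \<longrightarrow> P \<theta>)"
proof (intro iffI allI impI ballI)
  fix \<theta> assume "\<forall>V\<in>carrier Com. P (theory_of (V :: 'u sgrp set))" and \<theta>: "comm_theory \<theta>"
  then have "P (theory_of (models_of \<theta> :: 'u sgrp set))" using models_of_Com[OF \<theta>] by blast
  then show "P \<theta>" by (simp only: theory_of_models_of[OF \<theta>])
qed (use comm_theory_of_Com in blast)

lemma Com_closed:
  fixes V W :: "'u sgrp set"
  assumes "V \<in> carrier Com" "W \<in> carrier Com"
  shows "V \<sqinter>\<^bsub>Com\<^esub> W \<in> carrier Com" "V \<squnion>\<^bsub>Com\<^esub> W \<in> carrier Com"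
proof -
  interpret lattice "Com :: 'u sgrp set gorder" by (rule Com_lattice)
  show "V \<sqinter>\<^bsub>Com\<^esub> W \<in> carrier Com" "V \<squnion>\<^bsub>Com\<^esub> W \<in> carrier Com" using assms by simp_all
qed

lemma Com_le: "V \<sqsubseteq>\<^bsub>Com\<^esub> W \<longleftrightarrow> V \<subseteq> W"
  by (simp add: Com_def)

lemma costandard_iff:
  fixes V :: "'u sgrp set"
  assumes V: "V \<in> carrier Com"
  shows "costandard_element Com V \<longleftrightarrow> standard_theory (theory_of V)"
proof -
  have "costandard_element Com V \<longleftrightarrow> (\<forall>Y\<in>carrier Com. \<forall>Z\<in>carrier Com.
      join_theory (theory_of V) (theory_of (Y :: 'u sgrp set)) \<inter> theory_of (Z :: 'u sgrp set) =
      join_theory (theory_of V \<inter> theory_of Z) (theory_of Y \<inter> theory_of Z))"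
    unfolding costandard_element_def
    using V by (simp add: theory_of_eq_iff Com_closed theory_of_meet theory_of_join cong: ball_cong)
  also have "\<dots> \<longleftrightarrow> standard_theory (theory_of V)"
    unfolding standard_theory_def
      all_Com_iff[of "\<lambda>\<gamma>. join_theory (theory_of V) (theory_of _) \<inter> \<gamma> =
        join_theory (theory_of V \<inter> \<gamma>) (theory_of _ \<inter> \<gamma>)"]
      all_Com_iff[of "\<lambda>\<beta>. \<forall>\<gamma>. comm_theory \<gamma> \<longrightarrow> join_theory (theory_of V) \<beta> \<inter> \<gamma> =
        join_theory (theory_of V \<inter> \<gamma>) (\<beta> \<inter> \<gamma>)"]
    by blast
  finally show ?thesis .
qed

lemma modular_iff:
  fixes V :: "'u sgrp set"
  assumes V: "V \<in> carrier Com"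
  shows "modular_element Com V \<longleftrightarrow> modular_theory (theory_of V)"
proof -
  have "modular_element Com V \<longleftrightarrow> (\<forall>Y\<in>carrier Com. \<forall>Z\<in>carrier Com.
      theory_of (Z :: 'u sgrp set) \<subseteq> theory_of (Y :: 'u sgrp set) \<longrightarrow>
      join_theory (theory_of V \<inter> theory_of Y) (theory_of Z) =
      join_theory (theory_of V) (theory_of Z) \<inter> theory_of Y)"
    unfolding modular_element_def
    using V by (simp add: theory_of_eq_iff Com_closed theory_of_meet theory_of_join
        theory_of_subset_iff Com_le cong: ball_cong)
  also have "\<dots> \<longleftrightarrow> modular_theory (theory_of V)"
    unfolding modular_theory_def
      all_Com_iff[of "\<lambda>\<gamma>. \<gamma> \<subseteq> theory_of _ \<longrightarrow> join_theory (theory_of V \<inter> theory_of _) \<gamma> =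
        join_theory (theory_of V) \<gamma> \<inter> theory_of _"]
      all_Com_iff[of "\<lambda>\<beta>. \<forall>\<gamma>. comm_theory \<gamma> \<longrightarrow> \<gamma> \<subseteq> \<beta> \<longrightarrow>
        join_theory (theory_of V \<inter> \<beta>) \<gamma> = join_theory (theory_of V) \<gamma> \<inter> \<beta>"]
    by blast
  finally show ?thesis .
qed

lemma upper_modular_iff:
  fixes V :: "'u sgrp set"
  assumes V: "V \<in> carrier Com"
  shows "upper_modular_element Com V \<longleftrightarrow> lower_modular_theory (theory_of V)"
proof -
  have "upper_modular_element Com V \<longleftrightarrow> (\<forall>Y\<in>carrier Com. \<forall>Z\<in>carrier Com.
      theory_of V \<subseteq> theory_of (Y :: 'u sgrp set) \<longrightarrow>
      join_theory (theory_of V) (theory_of Y \<inter> theory_of (Z :: 'u sgrp set)) =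
      theory_of Y \<inter> join_theory (theory_of V) (theory_of Z))"
    unfolding upper_modular_element_def
    using V by (simp add: theory_of_eq_iff Com_closed theory_of_meet theory_of_join
        theory_of_subset_iff Com_le cong: ball_cong)
  also have "\<dots> \<longleftrightarrow> lower_modular_theory (theory_of V)"
    unfolding lower_modular_theory_def
      all_Com_iff[of "\<lambda>\<gamma>. theory_of V \<subseteq> theory_of _ \<longrightarrow> join_theory (theory_of V) (theory_of _ \<inter> \<gamma>) =
        theory_of _ \<inter> join_theory (theory_of V) \<gamma>"]
      all_Com_iff[of "\<lambda>\<beta>. \<forall>\<gamma>. comm_theory \<gamma> \<longrightarrow> theory_of V \<subseteq> \<beta> \<longrightarrow>
        join_theory (theory_of V) (\<beta> \<inter> \<gamma>) = \<beta> \<inter> join_theory (theory_of V) \<gamma>"]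
    by blast
  finally show ?thesis .
qed

lemma variety_satisfies_iff:
  assumes "V \<subseteq> COM_variety" "\<Sigma> \<subseteq> semigroup_identities"
  shows "variety_satisfies V \<Sigma> \<longleftrightarrow> (\<forall>(u, v)\<in>\<Sigma>. (mset u, mset v) \<in> theory_of V)"
proof -
  have "variety_satisfies V \<Sigma> \<longleftrightarrow> (\<forall>e\<in>\<Sigma>. \<forall>S\<in>V. satisfies S e)"
    unfolding variety_satisfies_def by blast
  also have "\<dots> \<longleftrightarrow> (\<forall>(u, v)\<in>\<Sigma>. (mset u, mset v) \<in> theory_of V)"
  proof (rule ball_cong[OF refl])
    fix e assume "e \<in> \<Sigma>"
    moreover obtain u v where e: "e = (u, v)" by (cases e)
    ultimately have "u \<noteq> []" "v \<noteq> []" using assms(2) by (auto simp: semigroup_identities_def)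
    then show "(\<forall>S\<in>V. satisfies S e) \<longleftrightarrow> (case e of (u, v) \<Rightarrow> (mset u, mset v) \<in> theory_of V)"
      using theory_of_iff[OF assms(1)] e by simp
  qed
  finally show ?thesis .
qed

lemma theory_of_COM: "theory_of (COM_variety :: 'u sgrp set) = equality_theory"
proof -
  have "(COM_variety :: 'u sgrp set) = models_of equality_theory"
  proof
    have "(models_of equality_theory :: 'u sgrp set) \<in> carrier Com"
      by (rule models_of_Com[OF comm_theory_equality])
    then show "(models_of equality_theory :: 'u sgrp set) \<subseteq> COM_variety"
      by (simp add: Com_carrier)
    show "(COM_variety :: 'u sgrp set) \<subseteq> models_of equality_theory"
    proof
      fix S :: "'u sgrp" assume S: "S \<in> COM_variety"
      have sat: "satisfies S (u, v)" if "u \<noteq> []" "mset u = mset v" for u v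
        using word_value_mset[OF S _ that] by (simp add: satisfies_def)
      show "S \<in> models_of equality_theory"
        using COM_semigroup[OF S]
        by (auto simp: models_of_def variety_of_def equality_theory_def intro!: sat)
    qed
  qed
  then show ?thesis using theory_of_models_of[OF comm_theory_equality] by simp
qed

lemma trivial_variety_Com: "(trivial_variety :: 'u sgrp set) \<in> carrier Com"
  and theory_of_trivial:
    "u \<noteq> {#} \<Longrightarrow> v \<noteq> {#} \<Longrightarrow> (u, v) \<in> theory_of (trivial_variety :: 'u sgrp set)"
proof -
  have one: "a = b" if S: "S \<in> trivial_variety" and ab: "a \<in> carrier S" "b \<in> carrier S"
    for S :: "'u sgrp" and a b
  proof -
    define h where "h n = (if n = 0 then a else b)" for n :: nat
    have "h \<in> UNIV \<rightarrow> carrier S" using ab by (simp add: h_def)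
    moreover have "satisfies S ([0], [1])" using S by (simp add: trivial_variety_def variety_of_def)
    ultimately have "word_value S h [0] = word_value S h [1]" unfolding satisfies_def by simp
    then show ?thesis by (simp add: h_def)
  qed
  have sat: "satisfies S (u, v)" if S: "S \<in> trivial_variety" and "u \<noteq> []" "v \<noteq> []"
    for S :: "'u sgrp" and u v
  proof -
    have "is_semigroup S" using S by (simp add: trivial_variety_def variety_of_def)
    then show ?thesis
      unfolding satisfies_def using one[OF S] word_value_closed[of S] that(2,3) by simp
  qed
  have var: "is_variety (trivial_variety :: 'u sgrp set)"
    unfolding trivial_variety_def by (rule is_varietyI) (simp add: semigroup_identities_def)
  have COM: "(trivial_variety :: 'u sgrp set) \<subseteq> COM_variety"
  proof
    fix S :: "'u sgrp" assume S: "S \<in> trivial_variety"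
    then have "is_semigroup S" by (simp add: trivial_variety_def variety_of_def)
    then show "S \<in> COM_variety" using sat[OF S] by (simp add: COM_variety_def variety_of_def)
  qed
  show "(trivial_variety :: 'u sgrp set) \<in> carrier Com" using var COM by (simp add: Com_carrier)
  show "(u, v) \<in> theory_of (trivial_variety :: 'u sgrp set)" if "u \<noteq> {#}" "v \<noteq> {#}"
  proof -
    obtain a b where "u = mset a" "v = mset b" using ex_mset by metis
    then show ?thesis using that theory_of_iff[OF COM, of a b] sat by auto
  qed
qed

lemma semilattice_variety_Com: "(semilattice_variety :: 'u sgrp set) \<in> carrier Com"
  unfolding Com_carrier
proof
  show "is_variety (semilattice_variety :: 'u sgrp set)"
    unfolding semilattice_variety_def by (rule is_varietyI) (simp add: semigroup_identities_def)
  show "(semilattice_variety :: 'u sgrp set) \<subseteq> COM_variety"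
    by (auto simp: semilattice_variety_def COM_variety_def variety_of_def)
qed

lemma theory_of_semilattice: "theory_of (semilattice_variety :: 'u sgrp set) = content_theory"
proof
  let ?\<sigma> = "theory_of (semilattice_variety :: 'u sgrp set)"
  have COM: "(semilattice_variety :: 'u sgrp set) \<subseteq> COM_variety"
    using semilattice_variety_Com by (simp add: Com_carrier)
  have \<sigma>: "comm_theory ?\<sigma>" by (rule comm_theory_theory_of[OF COM])
  have "(models_of content_theory :: 'u sgrp set) \<subseteq> semilattice_variety"
    by (auto simp: models_of_def semilattice_variety_def variety_of_def content_theory_def
      insert_commute)
  from theory_of_antimono[OF this] show "?\<sigma> \<subseteq> content_theory"
    unfolding theory_of_models_of[OF comm_theory_content] .
  have "(mset [0, 0], mset [0]) \<in> ?\<sigma>"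
    using theory_of_iff[OF COM, of "[0, 0]" "[0]"]
    by (simp add: semilattice_variety_def variety_of_def)
  then have idem: "({#0, 0#}, {#0#}) \<in> ?\<sigma>" by simp
  have absorb: "(u, u + t) \<in> ?\<sigma>" if u: "u \<noteq> {#}" and "set_mset t \<subseteq> set_mset u" for u t
    using that(2)
  proof (induction t)
    case empty
    then show ?case using theory_refl[OF \<sigma> u] by simp
  next
    case (add x t)
    then have IH: "(u, u + t) \<in> ?\<sigma>" and "x \<in># u + t" by auto
    then obtain w where w: "u + t = add_mset x w" by (blast dest: multi_member_split)
    have "(substitute (\<lambda>_. {#x#}) {#0, 0#}, substitute (\<lambda>_. {#x#}) {#0#}) \<in> ?\<sigma>"
      by (rule theory_substitute[OF \<sigma> idem]) simp
    then have "({#x, x#} + w, {#x#} + w) \<in> ?\<sigma>" by (intro theory_add[OF \<sigma>]) simp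
    then have "(u + t, u + t + {#x#}) \<in> ?\<sigma>" using theory_sym[OF \<sigma>] w by simp
    then show ?case using theory_trans[OF \<sigma> IH] by simp
  qed
  show "content_theory \<subseteq> ?\<sigma>"
  proof (intro subrelI)
    fix u v assume "(u, v) \<in> content_theory"
    then have uv: "u \<noteq> {#}" "v \<noteq> {#}" "set_mset u = set_mset v" by (auto simp: content_theory_def)
    have "(u, u + v) \<in> ?\<sigma>" using absorb[OF uv(1), of v] uv(3) by simp
    moreover have "(u + v, v) \<in> ?\<sigma>"
      using theory_sym[OF \<sigma> absorb[OF uv(2), of u]] uv(3) by (simp add: add.commute)
    ultimately show "(u, v) \<in> ?\<sigma>" by (rule theory_trans[OF \<sigma>])
  qed
qed

lemma zero_identity_words: "zero_identity [0, 0, 1, 2] \<subseteq> semigroup_identities"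
  by (auto simp: zero_identity_def semigroup_identities_def)

lemma variety_satisfies_swap:
  fixes V :: "'u sgrp set"
  assumes V: "V \<in> carrier Com"
  shows "variety_satisfies V {([0, 0, 1], [0, 1, 1])} \<longleftrightarrow> swaps_squares (theory_of V)"
proof -
  have COM: "V \<subseteq> COM_variety" using V by (simp add: Com_carrier)
  have "variety_satisfies V {([0, 0, 1], [0, 1, 1])} \<longleftrightarrow> ({#0, 0, 1#}, {#0, 1, 1#}) \<in> theory_of V"
    using variety_satisfies_iff[OF COM, of "{([0, 0, 1], [0, 1, 1])}"]
    by (simp add: semigroup_identities_def)
  also have "\<dots> \<longleftrightarrow> swaps_squares (theory_of V)"
    using swaps_squaresI[OF comm_theory_of_Com[OF V], of 0 1] unfolding swaps_squares_def by auto
  finally show ?thesis .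
qed

text \<open>Put \<open>M = SL\<close> exactly when every identity of \<open>V\<close> preserves the content. Since \<open>x\<^sup>2y = xy\<^sup>2\<close> holds in
  the trivial variety and in semilattices as well, the decomposition amounts to this one identity.\<close>

lemma decomposition_iff:
  fixes V :: "'u sgrp set"
  assumes V: "V \<in> carrier Com"
  shows "(\<exists>M N. (M = trivial_variety \<or> M = semilattice_variety) \<and> commutative_variety N \<and>
      variety_satisfies N (zero_identity [0, 0, 1, 2]) \<and>
      variety_satisfies N {([0, 0, 1], [0, 1, 1])} \<and> V = M \<squnion>\<^bsub>Com\<^esub> N)
    \<longleftrightarrow> swaps_squares (theory_of V)"
    (is "?L \<longleftrightarrow> ?R")
proof
  assume ?L
  then obtain M N where M: "M = trivial_variety \<or> M = semilattice_variety"
    and N: "N \<in> carrier Com" "variety_satisfies N {([0, 0, 1], [0, 1, 1])}"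
    and VMN: "V = M \<squnion>\<^bsub>Com\<^esub> N"
    by (auto simp: Com_def)
  have MC: "M \<in> carrier Com" using M trivial_variety_Com semilattice_variety_Com by blast
  have "swaps_squares (theory_of M)"
    using M theory_of_trivial theory_of_semilattice
    by (auto simp: swaps_squares_def content_theory_def)
  moreover have "swaps_squares (theory_of N)" using N variety_satisfies_swap by blast
  ultimately show ?R
    unfolding VMN theory_of_join[OF MC N(1)] by (simp add: swaps_squares_def)
next
  assume sw: ?R
  let ?\<alpha> = "theory_of V"
  have \<alpha>: "comm_theory ?\<alpha>" by (rule comm_theory_of_Com[OF V])
  have zero: "variety_satisfies N (zero_identity [0, 0, 1, 2])"
    if N: "N \<in> carrier Com" and tot: "\<And>u v. bulky u \<Longrightarrow> bulky v \<Longrightarrow> (u, v) \<in> theory_of N"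
    for N :: "'u sgrp set"
  proof -
    have b: "bulky {#0, 0, 1, 2#}" by (auto simp: bulky_def intro!: exI[of _ 0])
    have b': "bulky {#x, 0, 0, 1, 2#}" for x using bulky_add[OF b, of "{#x#}"] by simp
    have COM: "N \<subseteq> COM_variety" using N by (simp add: Com_carrier)
    show ?thesis
      unfolding variety_satisfies_iff[OF COM zero_identity_words]
      using tot[OF b' b] by (auto simp: zero_identity_def add_mset_commute)
  qed
  show ?L
  proof (cases "?\<alpha> \<subseteq> content_theory")
    case True
    let ?\<nu> = "join_theory ?\<alpha> bulky_theory"
    have \<nu>: "comm_theory ?\<nu>" by (rule comm_theory_join[OF \<alpha> comm_theory_bulky])
    define N :: "'u sgrp set" where "N = models_of ?\<nu>"
    have N: "N \<in> carrier Com" unfolding N_def by (rule models_of_Com[OF \<nu>])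
    have th: "theory_of N = ?\<nu>" unfolding N_def by (rule theory_of_models_of[OF \<nu>])
    have "variety_satisfies N (zero_identity [0, 0, 1, 2])"
    proof (rule zero[OF N])
      fix u v assume "bulky u" "bulky v"
      then have "(u, v) \<in> bulky_theory" using bulky_nonempty by (simp add: bulky_theory_def)
      then show "(u, v) \<in> theory_of N" unfolding th using join_theory_upper(2) by blast
    qed
    moreover have "swaps_squares (theory_of N)"
      using sw join_theory_upper(1) unfolding th swaps_squares_def by blast
    then have "variety_satisfies N {([0, 0, 1], [0, 1, 1])}" using variety_satisfies_swap[OF N] by blast
    moreover have "V = semilattice_variety \<squnion>\<^bsub>Com\<^esub> N"
      unfolding theory_of_eq_iff[OF V Com_closed(2)[OF semilattice_variety_Com N]]
        theory_of_join[OF semilattice_variety_Com N] theory_of_semilattice th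
      by (rule content_split[OF \<alpha> sw True])
    moreover have "commutative_variety N" using N by (simp add: Com_def)
    ultimately show ?thesis by blast
  next
    case False
    have "variety_satisfies V (zero_identity [0, 0, 1, 2])"
      by (rule zero[OF V]) (rule bulky_all_equal[OF \<alpha> sw False])
    moreover have "variety_satisfies V {([0, 0, 1], [0, 1, 1])}"
      using sw variety_satisfies_swap[OF V] by blast
    moreover have "?\<alpha> \<subseteq> theory_of (trivial_variety :: 'u sgrp set)"
      using theory_nonempty[OF \<alpha>] theory_of_trivial by auto
    then have "V = trivial_variety \<squnion>\<^bsub>Com\<^esub> V"
      unfolding theory_of_eq_iff[OF V Com_closed(2)[OF trivial_variety_Com V]]
        theory_of_join[OF trivial_variety_Com V] by blast
    moreover have "commutative_variety V" using V by (simp add: Com_def)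
    ultimately show ?thesis by blast
  qed
qed

end

theorem theorem1p2:
  fixes V :: "'u sgrp set"
  assumes "infinite (UNIV :: 'u set)"
    and "commutative_variety V"
  shows "(modular_element Com V \<and> upper_modular_element Com V \<longleftrightarrow> costandard_element Com V) \<and>
    (costandard_element Com V \<longleftrightarrow>
      V = COM_variety \<or>
      (\<exists>M N. (M = trivial_variety \<or> M = semilattice_variety) \<and>
        commutative_variety N \<and>
        variety_satisfies N (zero_identity [0, 0, 1, 2]) \<and>
        variety_satisfies N {([0, 0, 1], [0, 1, 1])} \<and>
        V = M \<squnion>\<^bsub>Com\<^esub> N))"
proof -
  have V: "V \<in> carrier Com" using assms(2) by (simp add: Com_def)
  have COM: "(COM_variety :: 'u sgrp set) \<in> carrier Com"
    using COM_variety_is_variety by (auto simp: Com_carrier)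
  have "V = COM_variety \<longleftrightarrow> theory_of V = equality_theory"
    using theory_of_eq_iff[OF assms(1) V COM] theory_of_COM[OF assms(1)] by simp
  then show ?thesis
    using standard_iff_swaps_squares[OF comm_theory_of_Com[OF assms(1) V]]
    unfolding decomposition_iff[OF assms(1) V] modular_iff[OF assms(1) V]
      upper_modular_iff[OF assms(1) V] costandard_iff[OF assms(1) V] by simp
qed

end
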